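(* Let $E,F$ be vector lattices with $F$ Dedekind complete, and let $A\subset\mathcal{U}_+(E,F)$ be an increasing (upwards directed) set, i.e. for all $S,T\in A$ there is $V\in A$ with $S\le V$ and $T\le V$. Then for every $T\in\mathcal{U}_+(E,F)$ and every $x\in E$, \[ (\pi_AT)(x)=\sup_{\varepsilon>0,\ S\in A}\ \inf_{y\in\mathcal{F}_x,\ \rho\in\mathfrak{P}(F)}\{\rho Ty+\rho^\perp Tx:\ \rho S(x-y)\le\varepsilon Sx\}, \] \[ (\pi_A^\perp T)(x)=\inf_{\varepsilon>0,\ S\in A}\ \sup_{y\in\mathcal{F}_x,\ \rho\in\mathfrak{P}(F)}\{\rho Ty:\ \rho Sy\le\varepsilon Sx\}. \]
   Context: For a vector lattice $E$, an element $z$ is a fragment of $x\in E$ if $|z|\wedge|x-z|=0$; $\mathcal{F}_x$ denotes the set of fragments of $x$. An operator $T\colon E\to F$ is orthogonally additive if $T(x+y)=Tx+Ty$ whenever $|x|\wedge|y|=0$. $\mathcal{U}(E,F)$ is the set of orthogonally additive, order bounded (in general nonlinear) operators $E\to F$, ordered by $S\le T$ iff $Tx-Sx\ge0$ for all $x$; $\mathcal{U}_+(E,F)$ is its positive cone; for Dedekind complete $F$ it is a Dedekind complete vector lattice. $\mathfrak{P}(F)$ is the Boolean algebra of band projections of $F$, and $\rho^\perp=I_F-\rho$. For $A\subset\mathcal{U}(E,F)$, $\pi_A$ denotes the band projection in $\mathcal{U}(E,F)$ onto the band $A^{\perp\perp}$ and $\pi_A^\perp=I-\pi_A$ the band projection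 onto $A^\perp$. Suprema and infima are taken in $F$. *)

theory Defs
  imports Complex_Main
begin

text \<open>Vector lattices are modelled by the type class combination
  ordered_real_vector + lattice; Dedekind complete vector lattices by
  ordered_real_vector + conditionally_complete_lattice.\<close>

definition vabs :: "'a::{ab_group_add, lattice} \<Rightarrow> 'a" where
  "vabs x = sup x (- x)"

definition vdisj :: "'a::{ab_group_add, lattice} \<Rightarrow> 'a \<Rightarrow> bool" where
  "vdisj x y \<longleftrightarrow> inf (vabs x) (vabs y) = 0"

definition fragments :: "'a::{ab_group_add, lattice} \<Rightarrow> 'a set" where
  "fragments x = {z. vdisj z (x - z)}"

definition orth_additive :: "('a::{ab_group_add, lattice} \<Rightarrow> 'b::ab_group_add) \<Rightarrow> bool" where
  "orth_additive T \<longleftrightarrow> (\<forall>x y. vdisj x y \<longrightarrow> T (x + y) = T x + T y)"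

definition order_bounded_op :: "('a::order \<Rightarrow> 'b::order) \<Rightarrow> bool" where
  "order_bounded_op T \<longleftrightarrow> (\<forall>a b. \<exists>c d. T ` {a..b} \<subseteq> {c..d})"

definition UOp :: "('a::{ordered_real_vector, lattice} \<Rightarrow> 'b::{ordered_real_vector, lattice}) set" where
  "UOp = {T. orth_additive T \<and> order_bounded_op T}"

definition U_sup :: "('a::{ordered_real_vector, lattice} \<Rightarrow> 'b::{ordered_real_vector, lattice})
    \<Rightarrow> ('a \<Rightarrow> 'b) \<Rightarrow> ('a \<Rightarrow> 'b)" where
  "U_sup S T = (THE V. V \<in> UOp \<and> S \<le> V \<and> T \<le> V \<and> (\<forall>W\<in>UOp. S \<le> W \<and> T \<le> W \<longrightarrow> V \<le> W))"

definition U_inf :: "('a::{ordered_real_vector, lattice} \<Rightarrow> 'b::{ordered_real_vector, lattice})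
    \<Rightarrow> ('a \<Rightarrow> 'b) \<Rightarrow> ('a \<Rightarrow> 'b)" where
  "U_inf S T = (THE V. V \<in> UOp \<and> V \<le> S \<and> V \<le> T \<and> (\<forall>W\<in>UOp. W \<le> S \<and> W \<le> T \<longrightarrow> W \<le> V))"

definition U_abs :: "('a::{ordered_real_vector, lattice} \<Rightarrow> 'b::{ordered_real_vector, lattice})
    \<Rightarrow> ('a \<Rightarrow> 'b)" where
  "U_abs T = U_sup T (\<lambda>x. - T x)"

definition U_disj :: "('a::{ordered_real_vector, lattice} \<Rightarrow> 'b::{ordered_real_vector, lattice})
    \<Rightarrow> ('a \<Rightarrow> 'b) \<Rightarrow> bool" where
  "U_disj S T \<longleftrightarrow> U_inf (U_abs S) (U_abs T) = (\<lambda>x. 0)"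

definition U_perp :: "('a::{ordered_real_vector, lattice} \<Rightarrow> 'b::{ordered_real_vector, lattice}) set
    \<Rightarrow> ('a \<Rightarrow> 'b) set" where
  "U_perp A = {T \<in> UOp. \<forall>S\<in>A. U_disj S T}"

definition U_bandproj :: "('a::{ordered_real_vector, lattice} \<Rightarrow> 'b::{ordered_real_vector, lattice}) set
    \<Rightarrow> ('a \<Rightarrow> 'b) \<Rightarrow> ('a \<Rightarrow> 'b)" where
  "U_bandproj A T = (THE P. P \<in> U_perp (U_perp A) \<and> (\<lambda>x. T x - P x) \<in> U_perp A)"

definition U_bandproj_perp :: "('a::{ordered_real_vector, lattice} \<Rightarrow> 'b::{ordered_real_vector, lattice}) set
    \<Rightarrow> ('a \<Rightarrow> 'b) \<Rightarrow> ('a \<Rightarrow> 'b)" where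
  "U_bandproj_perp A T = (\<lambda>x. T x - U_bandproj A T x)"

definition disj_compl :: "'a::{ab_group_add, lattice} set \<Rightarrow> 'a set" where
  "disj_compl B = {x. \<forall>y\<in>B. vdisj x y}"

definition is_ideal :: "'a::{ordered_real_vector, lattice} set \<Rightarrow> bool" where
  "is_ideal B \<longleftrightarrow> 0 \<in> B \<and> (\<forall>x\<in>B. \<forall>y\<in>B. x + y \<in> B) \<and> (\<forall>c::real. \<forall>x\<in>B. c *\<^sub>R x \<in> B)
     \<and> (\<forall>x\<in>B. \<forall>y. vabs y \<le> vabs x \<longrightarrow> y \<in> B)"

definition is_band :: "'a::{ordered_real_vector, conditionally_complete_lattice} set \<Rightarrow> bool" where
  "is_band B \<longleftrightarrow> is_ideal B \<and> (\<forall>D \<subseteq> B. D \<noteq> {} \<longrightarrow> bdd_above D \<longrightarrow> Sup D \<in> B)"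

definition band_projections :: "('a::{ordered_real_vector, conditionally_complete_lattice} \<Rightarrow> 'a) set" where
  "band_projections = {\<rho>. \<exists>B. is_band B \<and> (\<forall>x. \<rho> x \<in> B \<and> x - \<rho> x \<in> disj_compl B)}"

definition proj_compl :: "('a::ab_group_add \<Rightarrow> 'a) \<Rightarrow> 'a \<Rightarrow> 'a" where
  "proj_compl \<rho> = (\<lambda>x. x - \<rho> x)"

end

theory Submission
  imports Defs "HOL-Library.Lattice_Algebras"
begin

text \<open>
  Since \<open>A\<close> is directed, the projection \<open>P\<close> of \<open>T\<close> onto the band of \<open>A\<close> is the pointwise supremum
  of the operators \<open>T \<and> nS\<close> with \<open>S \<in> A\<close>; put \<open>R = T - P\<close>, so that \<open>R x\<close> is the infimum of the
  values \<open>(T - nS)\<^sup>+ x\<close>, and let \<open>G(\<epsilon>, S)\<close> be the inner supremum of the second formula.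

  If \<open>\<rho> S y \<le> \<epsilon> S x\<close>, then \<open>\<rho> T y = \<rho> (T - nS) y + n \<rho> S y \<le> (T - nS)\<^sup>+ x + n \<epsilon> S x\<close>. Letting
  \<open>\<epsilon>\<close> tend to 0 for fixed \<open>n\<close> gives \<open>inf G \<le> R x\<close>.

  Conversely, for a fragment \<open>y\<close> of \<open>x\<close> let \<open>\<rho>\<close> be the projection onto the disjoint complement of
  \<open>(S y - \<epsilon> S x)\<^sup>+\<close>. Then \<open>\<rho> S y \<le> \<epsilon> S x\<close> and \<open>\<rho>\<^sup>\<bottom> S x \<le> S y / \<epsilon>\<close>, and with \<open>p\<close> the projection of
  \<open>R x\<close> onto the band of \<open>S x\<close> one gets, for every \<open>m\<close>,
  \<open>R x \<le> G(\<epsilon>, S) + R (x - y) + (m / \<epsilon>) S y + (p - R x \<and> m S x)\<close>.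
  The infimum over \<open>y\<close> of \<open>R (x - y) + S y\<close> is \<open>(R \<and> S) x = 0\<close>, and the last term decreases to 0
  as \<open>m\<close> grows, whence \<open>R x \<le> G(\<epsilon>, S)\<close>.

  The substitution \<open>y \<mapsto> x - y\<close> turns the first formula into the second one.
\<close>

section \<open>Vector lattices and disjointness\<close>

interpretation vlat: lattice_ab_group_add_abs "vabs :: 'a::{ordered_real_vector,lattice} \<Rightarrow> 'a"
    "(+)" 0 "(-)" uminus "(\<le>)" "(<)" inf sup
  by unfold_locales (simp add: vabs_def)

text \<open>Distributivity turns the right-hand side into the infimum of \<open>w + w\<close>,
  \<open>w + y\<close>, \<open>x + w\<close> and \<open>x + y\<close>; for nonnegative elements each
  of these dominates \<open>inf w (x + y)\<close>.\<close>

lemma inf_add_le: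
  fixes w x y :: "'a::{ordered_real_vector,lattice}"
  assumes "0 \<le> w" "0 \<le> x" "0 \<le> y"
  shows "inf w (x + y) \<le> inf w x + inf w y"
proof -
  have "inf w x + inf w y = inf (inf (w + w) (w + y)) (inf (x + w) (x + y))"
    by (simp add: vlat.add_sup_inf_distribs inf.commute inf.left_commute inf.assoc)
  moreover have "inf w (x + y) \<le> w + w" "inf w (x + y) \<le> w + y" "inf w (x + y) \<le> x + w"
    using assms by (meson add_increasing add_increasing2 inf.cobounded1 order_trans)+
  ultimately show ?thesis by simp
qed

text \<open>The pieces \<open>inf w x\<close> and \<open>inf w y\<close> are themselves disjoint, so
  their sum is at most their supremum and stays below \<open>w\<close>.\<close>

lemma inf_add_disjoint:
  fixes w x y :: "'a::{ordered_real_vector,lattice}"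
  assumes "0 \<le> w" "0 \<le> x" "0 \<le> y" "inf x y = 0"
  shows "inf w (x + y) = inf w x + inf w y"
proof (rule antisym)
  show "inf w (x + y) \<le> inf w x + inf w y" by (rule inf_add_le[OF assms(1-3)])
  have "inf (inf w x) (inf w y) \<le> inf x y" by (simp add: le_infI1 le_infI2)
  then have "inf w x + inf w y \<le> sup (inf w x) (inf w y)"
    using vlat.add_eq_inf_sup[of "inf w x" "inf w y"] assms(4)
    by (metis add.right_neutral add_left_mono)
  also have "\<dots> \<le> w" by simp
  finally have "inf w x + inf w y \<le> w" .
  then show "inf w x + inf w y \<le> inf w (x + y)" by (simp add: add_mono)
qed

lemma vabs_ge [simp]:
  fixes x :: "'a::{ordered_real_vector,lattice}"
  shows "x \<le> vabs x" "- x \<le> vabs x"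
  by (simp_all add: vabs_def)

lemma vabs_leI:
  fixes x :: "'a::{ordered_real_vector,lattice}"
  shows "x \<le> y \<Longrightarrow> - x \<le> y \<Longrightarrow> vabs x \<le> y"
  by (simp add: vabs_def)

lemma vdisj_sym: "vdisj x y \<longleftrightarrow> vdisj y x"
  by (simp add: vdisj_def inf.commute)

lemma vdisj_mono:
  fixes x y :: "'a::{ordered_real_vector,lattice}"
  assumes "vdisj x y" "vabs z \<le> vabs x" "vabs w \<le> vabs y"
  shows "vdisj z w"
proof -
  have "inf (vabs z) (vabs w) \<le> inf (vabs x) (vabs y)" by (rule inf_mono[OF assms(2,3)])
  then show ?thesis using assms(1) unfolding vdisj_def
    by (metis antisym inf_greatest vlat.abs_ge_zero)
qed

lemma vdisj_nonneg_mono: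
  fixes x y :: "'a::{ordered_real_vector,lattice}"
  assumes "vdisj x y" "0 \<le> z" "z \<le> y"
  shows "vdisj x z"
proof (rule vdisj_mono[OF assms(1) order_refl])
  have "vabs z = z" using assms(2) by (rule vlat.abs_of_nonneg)
  also have "\<dots> \<le> vabs y" using assms(3) vabs_ge(1) by (rule order_trans)
  finally show "vabs z \<le> vabs y" .
qed

lemma vdisj_zero [simp]:
  fixes x :: "'a::{ordered_real_vector,lattice}"
  shows "vdisj x 0" "vdisj 0 x"
  by (simp_all add: vdisj_def inf_absorb1 inf_absorb2)

lemma vdisj_self_iff [simp]:
  fixes x :: "'a::{ordered_real_vector,lattice}"
  shows "vdisj x x \<longleftrightarrow> x = 0"
  by (simp add: vdisj_def)

lemma vdisj_minus [simp]:
  fixes x y :: "'a::{ordered_real_vector,lattice}"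
  shows "vdisj x (- y) \<longleftrightarrow> vdisj x y" "vdisj (- x) y \<longleftrightarrow> vdisj x y"
  by (simp_all add: vdisj_def)

lemma vdisj_add:
  fixes x y z :: "'a::{ordered_real_vector,lattice}"
  assumes "vdisj x y" "vdisj x z"
  shows "vdisj x (y + z)"
proof -
  have "inf (vabs x) (vabs (y + z)) \<le> inf (vabs x) (vabs y + vabs z)"
    by (intro inf_mono order_refl vlat.abs_triangle_ineq)
  also have "\<dots> \<le> inf (vabs x) (vabs y) + inf (vabs x) (vabs z)"
    by (intro inf_add_le) simp_all
  finally show ?thesis using assms by (simp add: vdisj_def antisym)
qed

lemma vdisj_diff:
  fixes x y z :: "'a::{ordered_real_vector,lattice}"
  shows "vdisj x y \<Longrightarrow> vdisj x z \<Longrightarrow> vdisj x (y - z)"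
  using vdisj_add[of x y "- z"] by simp

lemma vabs_scaleR_le:
  fixes z :: "'a::{ordered_real_vector,lattice}"
  shows "vabs (c *\<^sub>R z) \<le> \<bar>c\<bar> *\<^sub>R vabs z"
proof -
  have "s *\<^sub>R u \<le> \<bar>s\<bar> *\<^sub>R vabs u" for s and u :: 'a
  proof (cases "0 \<le> s")
    case True
    then show ?thesis by (simp add: scaleR_left_mono)
  next
    case False
    then have "(- s) *\<^sub>R (- u) \<le> (- s) *\<^sub>R vabs u"
      by (intro scaleR_left_mono vabs_ge) simp
    with False show ?thesis by simp
  qed
  from this[of c z] this[of c "- z"] show ?thesis by (intro vabs_leI) simp_all
qed

text \<open>Additivity handles natural multiples of \<open>vabs y\<close>; a natural number above
  \<open>\<bar>c\<bar>\<close> then takes care of a real factor.\<close>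

lemma vdisj_scaleR:
  fixes x y :: "'a::{ordered_real_vector,lattice}"
  assumes "vdisj x y"
  shows "vdisj x (c *\<^sub>R y)"
proof -
  have nat: "vdisj x (of_nat n *\<^sub>R vabs y)" for n
  proof (induction n)
    case (Suc n)
    have "vdisj x (vabs y)" using assms by (simp add: vdisj_def)
    with Suc show ?case by (simp add: scaleR_add_left vdisj_add)
  qed simp
  obtain n :: nat where n: "\<bar>c\<bar> \<le> of_nat n" using real_arch_simple by blast
  have "vabs (c *\<^sub>R y) \<le> \<bar>c\<bar> *\<^sub>R vabs y" by (rule vabs_scaleR_le)
  also have "\<dots> \<le> of_nat n *\<^sub>R vabs y" using n by (simp add: scaleR_right_mono)
  also have "\<dots> \<le> vabs (of_nat n *\<^sub>R vabs y)" by simp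
  finally show ?thesis using vdisj_mono[OF nat order_refl] by blast
qed

lemma vdisj_nonneg_iff:
  fixes x y :: "'a::{ordered_real_vector,lattice}"
  assumes "0 \<le> x" "0 \<le> y"
  shows "vdisj x y \<longleftrightarrow> inf x y = 0"
  using assms by (simp add: vdisj_def)

lemma vdisj_pos_neg_part:
  fixes x :: "'a::{ordered_real_vector,lattice}"
  shows "vdisj (sup x 0) (sup (- x) 0)"
proof -
  have "sup x 0 + - x = sup (- x) 0"
    by (simp only: vlat.add_sup_distrib_right) (simp add: sup.commute)
  then have "inf (sup x 0) (sup (- x) 0) = inf (sup x 0 + 0) (sup x 0 + - x)" by simp
  also have "\<dots> = sup x 0 + inf 0 (- x)" by (simp add: vlat.add_inf_distrib_left)
  also have "inf 0 (- x) = - sup x 0" by (simp add: vlat.neg_sup_eq_inf inf.commute)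
  finally have "inf (sup x 0) (sup (- x) 0) = 0" by (simp only: add.right_inverse)
  then show ?thesis by (simp add: vdisj_nonneg_iff)
qed

lemma pos_neg_part:
  fixes x :: "'a::{ordered_real_vector,lattice}"
  shows "x = sup x 0 - sup (- x) 0"
proof -
  have "sup x 0 + - x = sup (- x) 0"
    by (simp only: vlat.add_sup_distrib_right) (simp add: sup.commute)
  then show ?thesis by (metis add_diff_cancel_left' diff_minus_eq_add uminus_add_conv_diff add.commute minus_diff_eq)
qed

lemma vabs_diff_le:
  fixes a b :: "'a::{ordered_real_vector,lattice}"
  assumes "0 \<le> a" "0 \<le> b" "a \<le> c" "b \<le> c"
  shows "vabs (a - b) \<le> c"
  using assms by (intro vabs_leI) (simp_all add: add_increasing2 diff_le_eq)

lemma pos_part_eq_of_disjoint: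
  fixes a b :: "'a::{ordered_real_vector,lattice}"
  assumes "inf a b = 0"
  shows "sup (a - b) 0 = a"
proof -
  have "sup (a - b) 0 = sup (a + - b) (b + - b)" by simp
  also have "\<dots> = sup a b + - b" by (simp only: vlat.add_sup_distrib_right)
  also have "\<dots> = a" using vlat.add_eq_inf_sup[of a b] assms by (simp add: algebra_simps)
  finally show ?thesis .
qed

text \<open>The sums \<open>?a\<close> of the positive parts and \<open>?b\<close> of the negative
  parts are disjoint with difference \<open>x + y\<close>, and the positive part of a difference of
  disjoint elements is the first of them.\<close>

lemma pos_part_add_disjoint:
  fixes x y :: "'a::{ordered_real_vector,lattice}"
  assumes "vdisj x y"
  shows "sup (x + y) 0 = sup x 0 + sup y 0"
proof -
  let ?a = "sup x 0 + sup y 0" and ?b = "sup (- x) 0 + sup (- y) 0"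
  have d: "vdisj u v" if "vabs u \<le> vabs x" "vabs v \<le> vabs y" for u v
    using vdisj_mono[OF assms that] .
  have "vdisj (sup x 0) (sup (- y) 0)" "vdisj (sup (- x) 0) (sup y 0)"
    by (intro d; simp)+
  then have "vdisj ?a ?b"
    using vdisj_pos_neg_part[of x] vdisj_pos_neg_part[of y]
    by (meson vdisj_add vdisj_sym)
  then have "inf ?a ?b = 0" by (simp add: vdisj_nonneg_iff)
  then have "sup (?a - ?b) 0 = ?a" by (rule pos_part_eq_of_disjoint)
  moreover have "?a - ?b = x + y"
    using pos_neg_part[of x] pos_neg_part[of y] by (metis add_diff_add)
  ultimately show ?thesis by simp
qed

section \<open>Fragments, in particular those of a disjoint sum\<close>

lemma fragments_iff: "z \<in> fragments x \<longleftrightarrow> vdisj z (x - z)"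
  by (simp add: fragments_def)

lemma fragment_diff: "z \<in> fragments x \<Longrightarrow> x - z \<in> fragments x"
  by (simp add: fragments_iff vdisj_sym)

lemma trivial_fragments [simp]:
  fixes x :: "'a::{ordered_real_vector,lattice}"
  shows "0 \<in> fragments x" "x \<in> fragments x"
  by (simp_all add: fragments_iff)

lemma vabs_add_disjoint:
  fixes x y :: "'a::{ordered_real_vector,lattice}"
  assumes "vdisj x y"
  shows "vabs (x + y) = vabs x + vabs y"
proof -
  have abs: "vabs u = sup u 0 + sup (- u) 0" for u :: 'a
  proof -
    have "inf (sup u 0) (sup (- u) 0) = 0"
      using vdisj_pos_neg_part[of u] by (simp add: vdisj_nonneg_iff)
    then have eq: "sup u 0 + sup (- u) 0 = sup (sup u 0) (sup (- u) 0)"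
      using vlat.add_eq_inf_sup[of "sup u 0" "sup (- u) 0"] by simp
    show ?thesis unfolding eq by (intro antisym vabs_leI) (simp_all add: le_supI1 le_supI2)
  qed
  have "vdisj (- x) (- y)" using assms by simp
  from pos_part_add_disjoint[OF this] pos_part_add_disjoint[OF assms]
  show ?thesis by (simp add: abs algebra_simps)
qed

lemma fragment_vabs_le:
  fixes x :: "'a::{ordered_real_vector,lattice}"
  assumes "z \<in> fragments x"
  shows "vabs z \<le> vabs x"
  using vabs_add_disjoint[of z "x - z"] assms by (simp add: fragments_iff)

lemma fragments_add:
  fixes x y :: "'a::{ordered_real_vector,lattice}"
  assumes "vdisj x y" "u \<in> fragments x" "v \<in> fragments y"
  shows "u + v \<in> fragments (x + y)" "vdisj u v"
proof -
  have d: "vdisj a b" if "a \<in> fragments x" "b \<in> fragments y" for a b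
    using vdisj_mono[OF assms(1)] that fragment_vabs_le by blast
  show "vdisj u v" by (rule d[OF assms(2,3)])
  have "vdisj (u + v) ((x - u) + (y - v))"
    using d[OF assms(2,3)] d[OF assms(2) fragment_diff[OF assms(3)]]
      d[OF fragment_diff[OF assms(2)] assms(3)] assms(2,3)
    unfolding fragments_iff by (meson vdisj_add vdisj_sym)
  then show "u + v \<in> fragments (x + y)" by (simp add: fragments_iff algebra_simps)
qed

text \<open>With \<open>z\<close> the complement of \<open>w\<close>, both \<open>x + y\<close> and
  \<open>w + z\<close> are disjoint decompositions of one vector. Each summand is the sum of its
  common parts with the two summands of the other decomposition; \<open>u\<close> and
  \<open>v\<close> are the common parts of \<open>w\<close> with \<open>x\<close> and with
  \<open>y\<close>.\<close>

lemma fragments_add_decomp: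
  fixes x y :: "'a::{ordered_real_vector,lattice}"
  assumes xy: "vdisj x y" and w: "w \<in> fragments (x + y)"
  obtains u v where "u \<in> fragments x" "v \<in> fragments y" "w = u + v"
proof -
  define z where "z = x + y - w"
  have wz: "vdisj w z" and sum: "w + z = x + y" using w by (simp_all add: z_def fragments_iff)
  \<comment> \<open>The positive part of \<open>a\<close> lies below the sum of those of
    \<open>c\<close> and \<open>d\<close>, which are disjoint, so its infimum with that sum
    splits.\<close>
  have pos: "inf (sup a 0) (sup c 0) + inf (sup a 0) (sup d 0) = sup a 0"
    if "vdisj a b" "vdisj c d" "a + b = c + d" for a b c d :: 'a
  proof -
    have "sup a 0 + sup b 0 = sup c 0 + sup d 0"
      using pos_part_add_disjoint[OF that(1)] pos_part_add_disjoint[OF that(2)] that(3) by simp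
    then have "sup a 0 \<le> sup c 0 + sup d 0"
      by (metis add_increasing2 order_refl sup.cobounded2)
    moreover have "inf (sup c 0) (sup d 0) = 0"
    proof -
      have "vdisj (sup c 0) (sup d 0)"
        by (rule vdisj_mono[OF that(2)]) simp_all
      then show ?thesis by (simp add: vdisj_nonneg_iff)
    qed
    ultimately show ?thesis
      using inf_add_disjoint[of "sup a 0" "sup c 0" "sup d 0"] by (simp add: inf_absorb1)
  qed
  \<comment> \<open>\<open>m a b\<close> is the common part of \<open>a\<close> and \<open>b\<close>, formed separately on positive and negative parts.\<close>
  define m where "m a b = inf (sup a 0) (sup b 0) - inf (sup (- a) 0) (sup (- b) 0)" for a b :: 'a
  have m_comm: "m a b = m b a" for a b by (simp add: m_def inf.commute)
  have m_le: "vabs (m a b) \<le> vabs a" for a b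
    unfolding m_def by (rule vabs_diff_le) (auto simp: le_infI1)
  have m_add: "m a c + m a d = a"
    if "vdisj a b" "vdisj c d" "a + b = c + d" for a b c d
  proof -
    have "(- a) + (- b) = (- c) + (- d)" using that(3) by (metis minus_add_distrib)
    then have "inf (sup (- a) 0) (sup (- c) 0) + inf (sup (- a) 0) (sup (- d) 0) = sup (- a) 0"
      using that by (intro pos[of "- a" "- b"]) simp_all
    with pos[OF that] pos_neg_part[of a] show ?thesis
      by (metis m_def add_diff_add)
  qed
  have zw: "vdisj z w" and yx: "vdisj y x" using wz xy by (simp_all add: vdisj_sym)
  have x: "m x w + m x z = x" using m_add[OF xy wz] sum by simp
  have y: "m y w + m y z = y" using m_add[OF yx wz] sum by (simp add: add.commute)
  have "vdisj (m w a) (m z a)" for a using vdisj_mono[OF wz m_le m_le] .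
  then have "m x w \<in> fragments x" "m y w \<in> fragments y"
    using x y by (metis fragments_iff add_diff_cancel_left' m_comm)+
  moreover have "w = m x w + m y w" using m_add[OF wz xy sum] by (simp add: m_comm)
  ultimately show ?thesis using that by blast
qed

section \<open>Band decompositions\<close>

lemma disj_compl_iff: "x \<in> disj_compl B \<longleftrightarrow> (\<forall>y\<in>B. vdisj x y)"
  by (simp add: disj_compl_def)

lemma is_ideal_disj_compl:
  fixes C :: "'a::{ordered_real_vector,lattice} set"
  shows "is_ideal (disj_compl C)"
proof -
  let ?D = "disj_compl C"
  have sym: "x \<in> ?D \<longleftrightarrow> (\<forall>z\<in>C. vdisj z x)" for x by (simp add: disj_compl_iff vdisj_sym)
  have "vabs y \<le> vabs x \<Longrightarrow> y \<in> ?D" if "x \<in> ?D" for x y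
    using that vdisj_mono[OF _ order_refl] unfolding sym by blast
  then show ?thesis by (auto simp: is_ideal_def sym vdisj_add vdisj_scaleR)
qed

lemma ideal_diff:
  fixes B :: "'a::{ordered_real_vector,lattice} set"
  assumes "is_ideal B" "x \<in> B" "y \<in> B"
  shows "x - y \<in> B"
proof -
  have "(-1) *\<^sub>R y \<in> B" using assms unfolding is_ideal_def by blast
  then have "x + (-1) *\<^sub>R y \<in> B" using assms unfolding is_ideal_def by blast
  then show ?thesis by simp
qed

lemma disj_compl_Int:
  fixes B :: "'a::{ordered_real_vector,lattice} set"
  shows "x \<in> B \<Longrightarrow> x \<in> disj_compl B \<Longrightarrow> x = 0"
  using disj_compl_iff vdisj_self_iff by blast

lemma band_decomp_unique:
  fixes B :: "'a::{ordered_real_vector,lattice} set"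
  assumes "is_ideal B" "p \<in> B" "p' \<in> B" "v - p \<in> disj_compl B" "v - p' \<in> disj_compl B"
  shows "p = p'"
proof -
  have "p - p' = (v - p') - (v - p)" by simp
  then have "p - p' \<in> disj_compl B"
    using ideal_diff[OF is_ideal_disj_compl assms(5,4)] by simp
  then show ?thesis using ideal_diff[OF assms(1,2,3)] disj_compl_Int by fastforce
qed

text \<open>The supremum \<open>p\<close> enters only through \<open>upper\<close> and
  \<open>least\<close>, so that the result serves both a single generator in a Dedekind complete
  lattice and a directed set of operators. Each disjointness is shown by subtracting an infimum from
  \<open>p\<close> and finding that an upper bound remains.\<close>

lemma directed_band_decomp:
  fixes A :: "'a::{ordered_real_vector,lattice} set"
  assumes nonneg: "\<And>s. s \<in> A \<Longrightarrow> 0 \<le> s" and ne: "A \<noteq> {}"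
    and dir: "\<And>s s'. s \<in> A \<Longrightarrow> s' \<in> A \<Longrightarrow> \<exists>v\<in>A. s \<le> v \<and> s' \<le> v"
    and t: "0 \<le> t"
    and upper: "\<And>n s. s \<in> A \<Longrightarrow> inf t (of_nat n *\<^sub>R s) \<le> p"
    and least: "\<And>q. (\<And>n s. s \<in> A \<Longrightarrow> inf t (of_nat n *\<^sub>R s) \<le> q) \<Longrightarrow> p \<le> q"
  shows "0 \<le> p" "p \<le> t" "t - p \<in> disj_compl A" "p \<in> disj_compl (disj_compl A)"
proof -
  obtain s0 where "s0 \<in> A" using ne by blast
  from upper[OF this, of 0] t show p0: "0 \<le> p" by (simp add: inf_absorb2)
  show pt: "p \<le> t" by (rule least) simp
  have "inf (t - p) s = 0" if s: "s \<in> A" for s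
  proof (rule antisym)
    let ?w = "inf (t - p) s"
    \<comment> \<open>Adding \<open>?w\<close> raises the multiple by at most one: the sum stays
      below \<open>t\<close> and below \<open>n + 1\<close> times a common upper bound
      \<open>v\<close> of \<open>s\<close> and \<open>s'\<close>.\<close>
    have "p \<le> p - ?w"
    proof (rule least)
      fix n s' assume "s' \<in> A"
      then obtain v where v: "v \<in> A" "s \<le> v" "s' \<le> v" using dir s by blast
      have "inf t (of_nat n *\<^sub>R s') + ?w \<le> p + (t - p)"
        by (intro add_mono upper \<open>s' \<in> A\<close>) simp
      moreover have "inf t (of_nat n *\<^sub>R s') + ?w \<le> of_nat n *\<^sub>R v + v"
        using v by (intro add_mono le_infI2 scaleR_left_mono) simp_all
      ultimately have "inf t (of_nat n *\<^sub>R s') + ?w \<le> inf t (of_nat (Suc n) *\<^sub>R v)"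
        by (simp add: algebra_simps)
      also have "\<dots> \<le> p" by (rule upper[OF v(1)])
      finally show "inf t (of_nat n *\<^sub>R s') \<le> p - ?w" by (simp only: le_diff_eq)
    qed
    then show "?w \<le> 0" by (simp only: le_diff_eq add_le_same_cancel1)
    show "0 \<le> ?w" using pt nonneg[OF s] by simp
  qed
  then show "t - p \<in> disj_compl A"
    using pt nonneg by (auto simp: disj_compl_iff vdisj_nonneg_iff)
  \<comment> \<open>Here \<open>w - (p - q)\<close> lies below both \<open>a\<close> and
    \<open>q\<close>, hence below 0.\<close>
  have aux: "q \<le> p - w" if "w \<le> p" "w \<le> a" "q \<le> p" "inf a q = 0" for w a q
  proof -
    have "q + w \<le> p + a" using that(2,3) by (rule add_mono[rotated])
    then have "w - (p - q) \<le> inf a q"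
      using that(1) by (intro inf_greatest) (simp_all add: algebra_simps)
    with that(4) show ?thesis by (simp add: algebra_simps)
  qed
  have "vdisj p v" if v: "v \<in> disj_compl A" for v
  proof -
    let ?w = "inf p (vabs v)"
    have "p \<le> p - ?w"
    proof (rule least)
      fix n s assume s: "s \<in> A"
      let ?q = "inf t (of_nat n *\<^sub>R s)"
      have q0: "0 \<le> ?q" using t nonneg[OF s] by (simp add: scaleR_nonneg_nonneg)
      have "vdisj v (of_nat n *\<^sub>R s)" using v s by (auto simp: disj_compl_iff vdisj_scaleR)
      then have "vdisj v ?q" using q0 by (rule vdisj_nonneg_mono) simp
      then have "inf (vabs v) ?q = 0" using q0 by (simp add: vdisj_def)
      then show "?q \<le> p - ?w" using upper[OF s] by (intro aux[of _ "vabs v"]) simp_all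
    qed
    then have "?w \<le> 0" by (simp only: le_diff_eq add_le_same_cancel1)
    then show ?thesis using p0 by (simp add: vdisj_def antisym)
  qed
  then show "p \<in> disj_compl (disj_compl A)" by (simp add: disj_compl_iff)
qed

section \<open>Band projections of a Dedekind complete vector lattice\<close>

text \<open>The multiples of \<open>u\<close> are invariant under a shift by \<open>u\<close> up to
  their first term, so \<open>Sup ?D - u\<close> is still an upper bound.\<close>

lemma archimedean:
  fixes u v :: "'b::{ordered_real_vector,conditionally_complete_lattice}"
  assumes "\<And>n. of_nat n *\<^sub>R u \<le> v"
  shows "u \<le> 0"
proof -
  let ?D = "range (\<lambda>n. of_nat n *\<^sub>R u)"
  have bdd: "bdd_above ?D" using assms by (auto simp: bdd_above_def)
  have "Sup ?D \<le> Sup ?D - u"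
  proof (rule cSup_least)
    fix d assume "d \<in> ?D"
    then obtain n where d: "d = of_nat n *\<^sub>R u" by blast
    have "of_nat (Suc n) *\<^sub>R u \<le> Sup ?D" using bdd by (intro cSup_upper) blast+
    then show "d \<le> Sup ?D - u" by (simp add: d algebra_simps)
  qed simp
  then show ?thesis by simp
qed

text \<open>Elements of \<open>D\<close> may have any sign, so everything is measured from a fixed
  \<open>d0\<close> in \<open>D\<close>. Of \<open>s - d0\<close>, the part \<open>e\<close> coming
  from \<open>d\<close> is disjoint from \<open>c\<close>; hence \<open>?w\<close> is at most the
  remainder, which lies below \<open>s - d\<close>.\<close>

lemma is_band_disj_compl:
  fixes C :: "'b::{ordered_real_vector,conditionally_complete_lattice} set"
  shows "is_band (disj_compl C)"
  unfolding is_band_def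
proof (intro conjI allI impI is_ideal_disj_compl)
  fix D :: "'b set" assume D: "D \<subseteq> disj_compl C" "D \<noteq> {}" and bdd: "bdd_above D"
  define s where "s = Sup D"
  obtain d0 where d0: "d0 \<in> D" using D by blast
  have le: "d \<le> s" if "d \<in> D" for d using cSup_upper[OF that bdd] by (simp add: s_def)
  have "vdisj s c" if c: "c \<in> C" for c
  proof -
    have disj: "vdisj c d" if "d \<in> D" for d using that D c by (auto simp: disj_compl_iff vdisj_sym)
    let ?w = "inf (vabs c) (s - d0)"
    have "s \<le> s - ?w"
      unfolding s_def
    proof (rule cSup_least[OF D(2)], fold s_def)
      fix d assume d: "d \<in> D"
      define e where "e = sup (d - d0) 0"
      have e0: "0 \<le> e" by (simp add: e_def)
      have "vabs e \<le> vabs (d - d0)" by (simp add: e_def)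
      then have "vdisj c e" using vdisj_mono[OF vdisj_diff[OF disj[OF d] disj[OF d0]] order_refl] by blast
      then have ce: "inf (vabs c) e = 0" by (simp add: vdisj_def e_def)
      have eq: "e + d0 = sup d d0" unfolding e_def by (simp only: vlat.add_sup_distrib_right) simp
      have se: "e + d0 \<le> s" using le[OF d] le[OF d0] by (simp add: eq)
      have "?w = inf (vabs c) (e + (s - d0 - e))" by simp
      also have "\<dots> \<le> inf (vabs c) e + inf (vabs c) (s - d0 - e)"
        using se e0 by (intro inf_add_le) (simp_all add: algebra_simps)
      also have "\<dots> \<le> s - d0 - e" using ce by simp
      also have "\<dots> \<le> s - d"
        using sup.cobounded1[of d d0] unfolding eq[symmetric] by (simp add: algebra_simps)
      finally show "d \<le> s - ?w" by (simp only: le_diff_eq add.commute)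
    qed
    then have "?w \<le> 0" by (simp only: le_diff_eq add_le_same_cancel1)
    then have "?w = 0" using le[OF d0] by (intro antisym) simp_all
    then have "vdisj c (s - d0)" using le[OF d0] by (simp add: vdisj_def)
    from vdisj_add[OF this disj[OF d0]] show ?thesis by (simp add: vdisj_sym)
  qed
  then show "Sup D \<in> disj_compl C" by (simp add: disj_compl_iff s_def)
qed

section \<open>Linearity and positivity of a single band projection\<close>

context
  fixes \<rho> :: "'b::{ordered_real_vector,conditionally_complete_lattice} \<Rightarrow> 'b"
  assumes \<rho>: "\<rho> \<in> band_projections"
begin

text \<open>Membership in \<open>band_projections\<close> only says where the two components lie;
  linearity follows from uniqueness of such a decomposition.\<close>

lemma band_projection_add: "\<rho> (u + v) = \<rho> u + \<rho> v"
proof -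
  from \<rho> obtain B where B: "is_ideal B" "\<And>x. \<rho> x \<in> B" "\<And>x. x - \<rho> x \<in> disj_compl B"
    by (auto simp: band_projections_def is_band_def)
  have "\<rho> u + \<rho> v \<in> B" using B(1,2) unfolding is_ideal_def by blast
  moreover have "(u - \<rho> u) + (v - \<rho> v) \<in> disj_compl B"
    using is_ideal_disj_compl[of B] B(3) unfolding is_ideal_def by blast
  then have "(u + v) - (\<rho> u + \<rho> v) \<in> disj_compl B" by (simp add: algebra_simps)
  ultimately show ?thesis using band_decomp_unique[OF B(1)] B(2,3) by blast
qed

lemma band_projection_scaleR: "\<rho> (c *\<^sub>R v) = c *\<^sub>R \<rho> v"
proof -
  from \<rho> obtain B where B: "is_ideal B" "\<And>x. \<rho> x \<in> B" "\<And>x. x - \<rho> x \<in> disj_compl B"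
    by (auto simp: band_projections_def is_band_def)
  have "c *\<^sub>R \<rho> v \<in> B" using B(1,2) unfolding is_ideal_def by blast
  moreover have "c *\<^sub>R (v - \<rho> v) \<in> disj_compl B"
    using is_ideal_disj_compl[of B] B(3) unfolding is_ideal_def by blast
  then have "c *\<^sub>R v - c *\<^sub>R \<rho> v \<in> disj_compl B" by (simp add: algebra_simps)
  ultimately show ?thesis using band_decomp_unique[OF B(1)] B(2,3) by blast
qed

lemma band_projection_diff: "\<rho> (u - v) = \<rho> u - \<rho> v"
  using band_projection_add[of "u - v" v] by (simp add: algebra_simps)

lemma band_projection_zero: "\<rho> 0 = 0"
  using band_projection_diff[of 0 0] by simp

text \<open>The moduli of the two disjoint components add up to \<open>v\<close>, as do the
  components. So the nonnegative differences between modulus and component sum to 0 and both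
  vanish.\<close>

lemma band_projection_nonneg:
  assumes "0 \<le> v"
  shows "0 \<le> \<rho> v" "\<rho> v \<le> v"
proof -
  have "vdisj (\<rho> v) (v - \<rho> v)"
    using \<rho> by (auto simp: band_projections_def disj_compl_iff vdisj_sym)
  from vabs_add_disjoint[OF this] assms
  have eq: "(vabs (\<rho> v) - \<rho> v) + (vabs (v - \<rho> v) - (v - \<rho> v)) = 0"
    by (simp add: algebra_simps)
  have "0 \<le> vabs (\<rho> v) - \<rho> v" "0 \<le> vabs (v - \<rho> v) - (v - \<rho> v)"
    by simp_all
  with eq have "vabs (\<rho> v) = \<rho> v" "vabs (v - \<rho> v) = v - \<rho> v"
    by (simp_all only: add_nonneg_eq_0_iff right_minus_eq)
  then show "0 \<le> \<rho> v" "\<rho> v \<le> v" by (metis vlat.abs_ge_zero diff_ge_0_iff_ge)+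
qed

lemma band_projection_mono: "u \<le> v \<Longrightarrow> \<rho> u \<le> \<rho> v"
  using band_projection_nonneg(1)[of "v - u"] by (simp add: band_projection_diff)

end

text \<open>The directed set is \<open>{w}\<close>, and \<open>p\<close> is the projection of
  \<open>v\<close> onto the band generated by \<open>w\<close>. The first two conclusions keep
  \<open>p\<close> available as a least upper bound.\<close>

lemma principal_band_decomp:
  fixes v w :: "'b::{ordered_real_vector,conditionally_complete_lattice}"
  assumes "0 \<le> v" "0 \<le> w"
  defines "p \<equiv> Sup (range (\<lambda>n. inf v (of_nat n *\<^sub>R w)))"
  shows "inf v (of_nat n *\<^sub>R w) \<le> p" "(\<And>n. inf v (of_nat n *\<^sub>R w) \<le> q) \<Longrightarrow> p \<le> q"
    and "0 \<le> p" "p \<le> v" "v - p \<in> disj_compl {w}" "p \<in> disj_compl (disj_compl {w})"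
proof -
  have bdd: "bdd_above (range (\<lambda>n. inf v (of_nat n *\<^sub>R w)))"
    by (rule bdd_aboveI2[where M = v]) simp
  have upper: "inf v (of_nat n *\<^sub>R w) \<le> p" for n
    unfolding p_def by (rule cSup_upper[OF rangeI bdd])
  have least: "p \<le> q" if "\<And>n. inf v (of_nat n *\<^sub>R w) \<le> q" for q
    unfolding p_def by (rule cSUP_least) (simp, rule that)
  show "inf v (of_nat n *\<^sub>R w) \<le> p" by (rule upper)
  show "p \<le> q" if "\<And>n. inf v (of_nat n *\<^sub>R w) \<le> q" using that by (rule least)
  have nonneg: "0 \<le> s" if "s \<in> {w}" for s using that assms(2) by simp
  have dir: "\<exists>v\<in>{w}. s \<le> v \<and> s' \<le> v" if "s \<in> {w}" "s' \<in> {w}" for s s' using that by simp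
  have upper': "inf v (of_nat n *\<^sub>R s) \<le> p" if "s \<in> {w}" for n s using that upper by simp
  have least': "p \<le> q" if "\<And>n s. s \<in> {w} \<Longrightarrow> inf v (of_nat n *\<^sub>R s) \<le> q" for q
    by (rule least, rule that) simp
  show "0 \<le> p" "p \<le> v" "v - p \<in> disj_compl {w}" "p \<in> disj_compl (disj_compl {w})"
    by (rule directed_band_decomp[OF nonneg insert_not_empty dir assms(1) upper' least']; assumption)+
qed

text \<open>For nonnegative \<open>v\<close> the component wanted is the remainder of
  \<open>v\<close> after its part in the band of \<open>w\<close>; a general \<open>v\<close> is
  treated through its positive and negative parts.\<close>

lemma ex_projection_disj_compl:
  fixes w :: "'b::{ordered_real_vector,conditionally_complete_lattice}"
  assumes w: "0 \<le> w"
  obtains \<rho> where "\<rho> \<in> band_projections" "\<rho> w = 0" "\<And>v. vdisj v w \<Longrightarrow> \<rho> v = v"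
proof -
  let ?B = "disj_compl {w}"
  have "\<exists>p\<in>?B. v - p \<in> disj_compl ?B" for v
  proof -
    have *: "\<exists>p\<in>?B. v - p \<in> disj_compl ?B" if v: "0 \<le> v" for v
      using principal_band_decomp(5,6)[OF v w]
      by (intro bexI) simp_all
    obtain p q where "p \<in> ?B" "sup v 0 - p \<in> disj_compl ?B" "q \<in> ?B" "sup (- v) 0 - q \<in> disj_compl ?B"
      using *[of "sup v 0"] *[of "sup (- v) 0"] by auto
    then have "p - q \<in> ?B" "(sup v 0 - p) - (sup (- v) 0 - q) \<in> disj_compl ?B"
      by (simp_all add: ideal_diff is_ideal_disj_compl)
    moreover have "(sup v 0 - p) - (sup (- v) 0 - q) = v - (p - q)"
      using pos_neg_part[of v] by (simp add: algebra_simps)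
    ultimately show ?thesis by metis
  qed
  then obtain \<rho> where \<rho>: "\<And>v. \<rho> v \<in> ?B" "\<And>v. v - \<rho> v \<in> disj_compl ?B" by metis
  have "\<rho> \<in> band_projections"
    unfolding band_projections_def using is_band_disj_compl \<rho> by blast
  moreover have "w \<in> disj_compl ?B" by (auto simp: disj_compl_iff vdisj_sym)
  then have "w - (w - \<rho> w) \<in> disj_compl ?B" by (intro ideal_diff is_ideal_disj_compl \<rho>)
  then have "\<rho> w = 0" using disj_compl_Int[OF \<rho>(1)] by simp
  moreover have "\<rho> v = v" if "vdisj v w" for v
  proof -
    have "v - \<rho> v \<in> ?B" using that by (intro ideal_diff is_ideal_disj_compl \<rho>) (simp add: disj_compl_iff)
    then show ?thesis using disj_compl_Int[OF _ \<rho>(2), of v] by simp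
  qed
  ultimately show ?thesis using that by blast
qed

section \<open>The vector lattice of orthogonally additive operators\<close>

lemma UOp_iff:
  "T \<in> UOp \<longleftrightarrow> (\<forall>x y. vdisj x y \<longrightarrow> T (x + y) = T x + T y) \<and>
     (\<forall>a b. \<exists>c d. \<forall>x. a \<le> x \<and> x \<le> b \<longrightarrow> c \<le> T x \<and> T x \<le> d)"
  by (simp add: UOp_def orth_additive_def order_bounded_op_def image_subset_iff Ball_def)

lemma UOp_add: "T \<in> UOp \<Longrightarrow> vdisj x y \<Longrightarrow> T (x + y) = T x + T y"
  by (simp add: UOp_iff)

lemma UOp_bounded:
  assumes "T \<in> UOp"
  obtains c d where "\<And>x. a \<le> x \<Longrightarrow> x \<le> b \<Longrightarrow> c \<le> T x \<and> T x \<le> d"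
  using assms unfolding UOp_iff by metis

lemma UOp_zero: "T \<in> UOp \<Longrightarrow> T 0 = 0"
  using UOp_add[of T 0 0] by simp

lemma UOp_fragment: "T \<in> UOp \<Longrightarrow> y \<in> fragments x \<Longrightarrow> T x = T y + T (x - y)"
  using UOp_add[of T y "x - y"] by (simp add: fragments_iff)

lemma UOp_fragment_mono:
  assumes "T \<in> UOp" "(\<lambda>_. 0) \<le> T" "y \<in> fragments x"
  shows "T y \<le> T x"
  using UOp_fragment[OF assms(1,3)] assms(2) by (simp add: le_fun_def)

lemma UOp_const_zero: "(\<lambda>_. 0) \<in> UOp"
  by (auto simp: UOp_iff)

lemma UOp_plus:
  assumes "S \<in> UOp" "T \<in> UOp"
  shows "(\<lambda>x. S x + T x) \<in> UOp"
proof -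
  have "\<exists>c d. \<forall>x. a \<le> x \<and> x \<le> b \<longrightarrow> c \<le> S x + T x \<and> S x + T x \<le> d" for a b
  proof -
    obtain c d c' d' where "\<And>x. a \<le> x \<Longrightarrow> x \<le> b \<Longrightarrow> c \<le> S x \<and> S x \<le> d"
      "\<And>x. a \<le> x \<Longrightarrow> x \<le> b \<Longrightarrow> c' \<le> T x \<and> T x \<le> d'"
      using UOp_bounded[OF assms(1), of a b] UOp_bounded[OF assms(2), of a b] by metis
    then show ?thesis by (intro exI[of _ "c + c'"] exI[of _ "d + d'"]) (simp add: add_mono)
  qed
  then show ?thesis using assms by (simp add: UOp_iff algebra_simps)
qed

lemma UOp_uminus:
  assumes "T \<in> UOp"
  shows "(\<lambda>x. - T x) \<in> UOp"
proof -
  have "\<exists>c d. \<forall>x. a \<le> x \<and> x \<le> b \<longrightarrow> c \<le> - T x \<and> - T x \<le> d" for a b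
    using UOp_bounded[OF assms, of a b] by (metis neg_le_iff_le)
  then show ?thesis using assms by (simp add: UOp_iff)
qed

lemma UOp_scaleR:
  assumes "T \<in> UOp"
  shows "(\<lambda>x. r *\<^sub>R T x) \<in> UOp"
proof -
  have nonneg: "(\<lambda>x. r *\<^sub>R T x) \<in> UOp" if "0 \<le> r" for r
  proof -
    have "\<exists>c d. \<forall>x. a \<le> x \<and> x \<le> b \<longrightarrow> c \<le> r *\<^sub>R T x \<and> r *\<^sub>R T x \<le> d" for a b
      using UOp_bounded[OF assms, of a b] by (metis scaleR_left_mono[OF _ that])
    then show ?thesis using assms by (simp add: UOp_iff scaleR_add_right)
  qed
  show ?thesis
  proof (cases "0 \<le> r")
    case False
    then have "(\<lambda>x. - ((- r) *\<^sub>R T x)) \<in> UOp" by (intro UOp_uminus nonneg) simp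
    then show ?thesis by simp
  qed (rule nonneg)
qed

lemma UOp_minus:
  assumes "S \<in> UOp" "T \<in> UOp"
  shows "(\<lambda>x. S x - T x) \<in> UOp"
  using UOp_plus[OF assms(1) UOp_uminus[OF assms(2)]] by simp

text \<open>Riesz-Kantorovich formula for the positive part of \<open>T\<close> in the lattice of
  operators, with fragments of \<open>x\<close> in the role of the order interval from 0 to
  \<open>x\<close>.\<close>

definition op_pos_part ::
  "('a::{ordered_real_vector,lattice} \<Rightarrow> 'b::{ordered_real_vector,conditionally_complete_lattice}) \<Rightarrow> 'a \<Rightarrow> 'b"
  where "op_pos_part T x = Sup (T ` fragments x)"

text \<open>The bound is uniform over the interval, as order boundedness of
  \<open>op_pos_part T\<close> demands: all fragments concerned have modulus at most
  \<open>vabs a + vabs b\<close>.\<close>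

lemma UOp_fragments_bounded:
  fixes T :: "'a::{ordered_real_vector,lattice} \<Rightarrow> 'b::{ordered_real_vector,conditionally_complete_lattice}"
  assumes "T \<in> UOp"
  shows "\<exists>d. \<forall>x y. a \<le> x \<longrightarrow> x \<le> b \<longrightarrow> y \<in> fragments x \<longrightarrow> T y \<le> d"
proof -
  let ?c = "vabs a + vabs b"
  obtain d where d: "\<And>x. - ?c \<le> x \<Longrightarrow> x \<le> ?c \<Longrightarrow> T x \<le> d"
    using UOp_bounded[OF assms, of "- ?c" ?c] by metis
  have "T y \<le> d" if "a \<le> x" "x \<le> b" "y \<in> fragments x" for x y
  proof (rule d)
    have "x \<le> ?c" using that(2) by (meson add_increasing order_trans vabs_ge(1) vlat.abs_ge_zero)
    moreover have "- x \<le> ?c"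
      using that(1) by (meson add_increasing2 neg_le_iff_le order_trans vabs_ge(2) vlat.abs_ge_zero)
    ultimately have "vabs y \<le> ?c"
      using fragment_vabs_le[OF that(3)] vabs_leI order_trans by blast
    then show "y \<le> ?c" "- ?c \<le> y" using vabs_ge[of y] order_trans minus_le_iff by blast+
  qed
  then show ?thesis by blast
qed

lemma op_pos_part_upper:
  fixes T :: "'a::{ordered_real_vector,lattice} \<Rightarrow> 'b::{ordered_real_vector,conditionally_complete_lattice}"
  assumes "T \<in> UOp" "y \<in> fragments x"
  shows "T y \<le> op_pos_part T x"
proof -
  obtain d where "\<And>y. y \<in> fragments x \<Longrightarrow> T y \<le> d"
    using UOp_fragments_bounded[OF assms(1), of x x] by auto
  then have "bdd_above (T ` fragments x)" by (auto simp: bdd_above_def)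
  then show ?thesis unfolding op_pos_part_def using assms(2) by (intro cSup_upper) blast+
qed

lemma op_pos_part_least:
  fixes T :: "'a::{ordered_real_vector,lattice} \<Rightarrow> 'b::{ordered_real_vector,conditionally_complete_lattice}"
  assumes "\<And>y. y \<in> fragments x \<Longrightarrow> T y \<le> d"
  shows "op_pos_part T x \<le> d"
  unfolding op_pos_part_def by (rule cSup_least) (use assms trivial_fragments in blast)+

text \<open>The fragments of a disjoint sum are exactly the sums of fragments of the summands, so
  the supremum splits. The fragment 0 supplies the lower bound 0.\<close>

lemma UOp_op_pos_part:
  fixes T :: "'a::{ordered_real_vector,lattice} \<Rightarrow> 'b::{ordered_real_vector,conditionally_complete_lattice}"
  assumes T: "T \<in> UOp"
  shows "op_pos_part T \<in> UOp"
  unfolding UOp_iff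
proof (intro conjI allI impI)
  fix x y :: 'a assume xy: "vdisj x y"
  show "op_pos_part T (x + y) = op_pos_part T x + op_pos_part T y"
  proof (rule antisym)
    show "op_pos_part T (x + y) \<le> op_pos_part T x + op_pos_part T y"
    proof (rule op_pos_part_least)
      fix w assume "w \<in> fragments (x + y)"
      then obtain u v where uv: "u \<in> fragments x" "v \<in> fragments y" "w = u + v"
        using fragments_add_decomp[OF xy] by blast
      then have "T w = T u + T v" using UOp_add[OF T fragments_add(2)[OF xy]] by blast
      then show "T w \<le> op_pos_part T x + op_pos_part T y"
        using uv by (simp add: add_mono op_pos_part_upper[OF T])
    qed
    have "T v + T u \<le> op_pos_part T (x + y)" if "u \<in> fragments x" "v \<in> fragments y" for u v
      using op_pos_part_upper[OF T fragments_add(1)[OF xy that]] UOp_add[OF T fragments_add(2)[OF xy that]]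
      by (simp add: add.commute)
    then have "op_pos_part T y \<le> op_pos_part T (x + y) - T u" if "u \<in> fragments x" for u
      using that by (intro op_pos_part_least) (simp add: le_diff_eq)
    then have "op_pos_part T x \<le> op_pos_part T (x + y) - op_pos_part T y"
      by (intro op_pos_part_least) (simp add: algebra_simps)
    then show "op_pos_part T x + op_pos_part T y \<le> op_pos_part T (x + y)" by (simp add: le_diff_eq)
  qed
next
  fix a b :: 'a
  obtain d where d: "\<And>x y. a \<le> x \<Longrightarrow> x \<le> b \<Longrightarrow> y \<in> fragments x \<Longrightarrow> T y \<le> d"
    using UOp_fragments_bounded[OF T, of a b] by auto
  have "0 \<le> op_pos_part T x" for x
    using op_pos_part_upper[OF T, of 0 x] UOp_zero[OF T] by simp
  then show "\<exists>c d. \<forall>x. a \<le> x \<and> x \<le> b \<longrightarrow> c \<le> op_pos_part T x \<and> op_pos_part T x \<le> d"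
    using d by (intro exI[of _ 0] exI[of _ d]) (auto intro: op_pos_part_least)
qed

text \<open>As a type, the operators inherit all facts about vector lattices proved above.\<close>

typedef (overloaded) ('a, 'b) uop =
  "UOp :: ('a::{ordered_real_vector,lattice} \<Rightarrow> 'b::{ordered_real_vector,conditionally_complete_lattice}) set"
  morphisms app Uop
  using UOp_const_zero by blast

setup_lifting type_definition_uop

instantiation uop :: ("{ordered_real_vector,lattice}", "{ordered_real_vector,conditionally_complete_lattice}")
  "{ordered_real_vector,lattice}"
begin

lift_definition zero_uop :: "('a, 'b) uop" is "\<lambda>_. 0" by (rule UOp_const_zero)
lift_definition plus_uop :: "('a, 'b) uop \<Rightarrow> ('a, 'b) uop \<Rightarrow> ('a, 'b) uop"
  is "\<lambda>S T x. S x + T x" by (rule UOp_plus)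
lift_definition minus_uop :: "('a, 'b) uop \<Rightarrow> ('a, 'b) uop \<Rightarrow> ('a, 'b) uop"
  is "\<lambda>S T x. S x - T x" by (rule UOp_minus)
lift_definition uminus_uop :: "('a, 'b) uop \<Rightarrow> ('a, 'b) uop"
  is "\<lambda>T x. - T x" by (rule UOp_uminus)
lift_definition scaleR_uop :: "real \<Rightarrow> ('a, 'b) uop \<Rightarrow> ('a, 'b) uop"
  is "\<lambda>r T x. r *\<^sub>R T x" by (rule UOp_scaleR)
lift_definition less_eq_uop :: "('a, 'b) uop \<Rightarrow> ('a, 'b) uop \<Rightarrow> bool" is "(\<le>)" .
lift_definition less_uop :: "('a, 'b) uop \<Rightarrow> ('a, 'b) uop \<Rightarrow> bool" is "(<)" .
text \<open>In any lattice-ordered group the supremum is \<open>T\<close> plus the positive part of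
  \<open>S - T\<close>, and the infimum is \<open>S\<close> minus it; these identities are taken as
  definitions.\<close>

lift_definition sup_uop :: "('a, 'b) uop \<Rightarrow> ('a, 'b) uop \<Rightarrow> ('a, 'b) uop"
  is "\<lambda>S T x. T x + op_pos_part (\<lambda>y. S y - T y) x"
  by (intro UOp_plus UOp_op_pos_part UOp_minus)
lift_definition inf_uop :: "('a, 'b) uop \<Rightarrow> ('a, 'b) uop \<Rightarrow> ('a, 'b) uop"
  is "\<lambda>S T x. S x - op_pos_part (\<lambda>y. S y - T y) x"
  by (intro UOp_minus UOp_op_pos_part)

instance
proof
  fix f g h :: "('a, 'b) uop" and r s :: real
  show "f + g + h = f + (g + h)" "f + g = g + f" "0 + f = f" "- f + f = 0" "f - g = f + - g"
    by (transfer; simp add: algebra_simps)+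
  show "r *\<^sub>R (f + g) = r *\<^sub>R f + r *\<^sub>R g" "(r + s) *\<^sub>R f = r *\<^sub>R f + s *\<^sub>R f"
    "r *\<^sub>R s *\<^sub>R f = (r * s) *\<^sub>R f" "1 *\<^sub>R f = f"
    by (transfer; simp add: algebra_simps)+
  show "f \<le> f" "f \<le> g \<Longrightarrow> g \<le> h \<Longrightarrow> f \<le> h" "f \<le> g \<Longrightarrow> g \<le> f \<Longrightarrow> f = g"
    "f < g \<longleftrightarrow> f \<le> g \<and> \<not> g \<le> f"
    by (transfer; auto)+
  show "f \<le> g \<Longrightarrow> h + f \<le> h + g" "f \<le> g \<Longrightarrow> 0 \<le> r \<Longrightarrow> r *\<^sub>R f \<le> r *\<^sub>R g"
    "r \<le> s \<Longrightarrow> 0 \<le> f \<Longrightarrow> r *\<^sub>R f \<le> s *\<^sub>R f"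
    by (transfer; auto simp: le_fun_def intro: scaleR_left_mono scaleR_right_mono)+
  have pos: "S x - T x \<le> op_pos_part (\<lambda>y. S y - T y) x" "0 \<le> op_pos_part (\<lambda>y. S y - T y) x"
    if "S \<in> UOp" "T \<in> UOp" for S T :: "'a \<Rightarrow> 'b" and x
    using op_pos_part_upper[OF UOp_minus[OF that], of x x] op_pos_part_upper[OF UOp_minus[OF that], of 0 x] that
    by (simp_all add: UOp_zero)
  \<comment> \<open>A nonnegative operator increases from a fragment to the whole vector, so a
    pointwise bound \<open>V\<close> at \<open>y\<close> is also one at \<open>x\<close>.\<close>
  have least: "op_pos_part (\<lambda>y. S y - T y) x \<le> V x"
    if "V \<in> UOp" "\<And>x. S x - T x \<le> V x" "\<And>x. 0 \<le> V x" for S T V :: "'a \<Rightarrow> 'b" and x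
  proof (rule op_pos_part_least)
    fix y assume "y \<in> fragments x"
    then have "V y \<le> V x" using that by (intro UOp_fragment_mono) (auto simp: le_fun_def)
    then show "S y - T y \<le> V x" using that(2)[of y] by (rule order_trans[rotated])
  qed
  show "f \<le> sup f g" "g \<le> sup f g" "inf f g \<le> f" "inf f g \<le> g"
    by (transfer; use pos in \<open>auto simp: le_fun_def algebra_simps\<close>)+
  show "sup g h \<le> f" if "g \<le> f" "h \<le> f"
    using that
  proof transfer
    fix G H F :: "'a \<Rightarrow> 'b" assume "G \<in> UOp" "H \<in> UOp" "F \<in> UOp" "G \<le> F" "H \<le> F"
    then have "op_pos_part (\<lambda>y. G y - H y) x \<le> F x - H x" for x
      by (intro least[where V = "\<lambda>x. F x - H x"] UOp_minus) (auto simp: le_fun_def)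
    then show "(\<lambda>x. H x + op_pos_part (\<lambda>y. G y - H y) x) \<le> F"
      by (simp add: le_fun_def algebra_simps)
  qed
  show "f \<le> inf g h" if "f \<le> g" "f \<le> h"
    using that
  proof transfer
    fix F G H :: "'a \<Rightarrow> 'b" assume "F \<in> UOp" "G \<in> UOp" "H \<in> UOp" "F \<le> G" "F \<le> H"
    then have "op_pos_part (\<lambda>y. G y - H y) x \<le> G x - F x" for x
      by (intro least[where V = "\<lambda>x. G x - F x"] UOp_minus) (auto simp: le_fun_def)
    then show "F \<le> (\<lambda>x. G x - op_pos_part (\<lambda>y. G y - H y) x)"
      by (simp add: le_fun_def algebra_simps)
  qed
qed

end

section \<open>Transfer of the set-based operator notions to the type\<close>

lemma app_UOp [simp]: "app f \<in> UOp"
  by (rule app)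

lemmas le_app_iff = less_eq_uop.rep_eq

lemma U_sup_app: "U_sup (app f) (app g) = app (sup f g)"
  unfolding U_sup_def
proof (rule the_equality)
  show *: "app (sup f g) \<in> UOp \<and> app f \<le> app (sup f g) \<and> app g \<le> app (sup f g) \<and>
      (\<forall>W\<in>UOp. app f \<le> W \<and> app g \<le> W \<longrightarrow> app (sup f g) \<le> W)"
  proof (intro conjI ballI impI app_UOp)
    fix W :: "'a \<Rightarrow> 'b" assume "W \<in> UOp" "app f \<le> W \<and> app g \<le> W"
    then show "app (sup f g) \<le> W" by (metis Uop_inverse le_app_iff sup_least)
  qed (simp_all flip: le_app_iff)
  fix V assume "V \<in> UOp \<and> app f \<le> V \<and> app g \<le> V \<and> (\<forall>W\<in>UOp. app f \<le> W \<and> app g \<le> W \<longrightarrow> V \<le> W)"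
  with * show "V = app (sup f g)" by (meson antisym)
qed

lemma U_inf_app: "U_inf (app f) (app g) = app (inf f g)"
  unfolding U_inf_def
proof (rule the_equality)
  show *: "app (inf f g) \<in> UOp \<and> app (inf f g) \<le> app f \<and> app (inf f g) \<le> app g \<and>
      (\<forall>W\<in>UOp. W \<le> app f \<and> W \<le> app g \<longrightarrow> W \<le> app (inf f g))"
  proof (intro conjI ballI impI app_UOp)
    fix W :: "'a \<Rightarrow> 'b" assume "W \<in> UOp" "W \<le> app f \<and> W \<le> app g"
    then show "W \<le> app (inf f g)" by (metis Uop_inverse le_app_iff inf_greatest)
  qed (simp_all flip: le_app_iff)
  fix V assume "V \<in> UOp \<and> V \<le> app f \<and> V \<le> app g \<and> (\<forall>W\<in>UOp. W \<le> app f \<and> W \<le> app g \<longrightarrow> W \<le> V)"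
  with * show "V = app (inf f g)" by (meson antisym)
qed

lemma U_abs_app: "U_abs (app f) = app (vabs f)"
  by (simp add: U_abs_def vabs_def U_sup_app flip: uminus_uop.rep_eq)

lemma U_disj_app: "U_disj (app f) (app g) \<longleftrightarrow> vdisj f g"
  by (simp add: U_disj_def vdisj_def U_abs_app U_inf_app app_inject flip: zero_uop.rep_eq)

lemma U_perp_app: "U_perp (app ` B) = app ` disj_compl B"
proof -
  have "T \<in> U_perp (app ` B) \<longleftrightarrow> T \<in> app ` disj_compl B" for T :: "'a \<Rightarrow> 'b"
  proof (cases "T \<in> UOp")
    case True
    then obtain f where "T = app f" using Uop_inverse by metis
    then show ?thesis
      by (auto simp: U_perp_def U_disj_app disj_compl_iff app_inject vdisj_sym)
  qed (auto simp: U_perp_def)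
  then show ?thesis by blast
qed

text \<open>Uniqueness is that of band decompositions for the double complement of \<open>B\<close>;
  it applies because \<open>disj_compl B\<close> is contained in the triple complement.\<close>

lemma U_bandproj_app:
  assumes "p \<in> disj_compl (disj_compl B)" "t - p \<in> disj_compl B"
  shows "U_bandproj (app ` B) (app t) = app p"
  unfolding U_bandproj_def U_perp_app
proof (rule the_equality)
  have mem: "(\<lambda>x. app t x - app q x) \<in> app ` disj_compl B \<longleftrightarrow> t - q \<in> disj_compl B" for q
    by (auto simp: app_inject simp flip: minus_uop.rep_eq)
  show "app p \<in> app ` disj_compl (disj_compl B) \<and> (\<lambda>x. app t x - app p x) \<in> app ` disj_compl B"
    using assms mem by blast
  fix P assume P: "P \<in> app ` disj_compl (disj_compl B) \<and> (\<lambda>x. app t x - P x) \<in> app ` disj_compl B"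
  then obtain q where q: "P = app q" "q \<in> disj_compl (disj_compl B)" by blast
  with P mem have "t - q \<in> disj_compl B" by simp
  moreover have "v \<in> disj_compl (disj_compl (disj_compl B))" if "v \<in> disj_compl B" for v
    using that by (auto simp: disj_compl_iff vdisj_sym)
  ultimately have "q = p"
    using assms q(2) by (intro band_decomp_unique[OF is_ideal_disj_compl]) blast+
  with q show "P = app p" by simp
qed

text \<open>Directedness gives superadditivity: \<open>f\<close> used at \<open>x\<close> and
  \<open>g\<close> used at \<open>y\<close> are replaced by one common upper bound
  \<open>h\<close>.\<close>

lemma directed_Sup_UOp:
  fixes D :: "('a::{ordered_real_vector,lattice}, 'b::{ordered_real_vector,conditionally_complete_lattice}) uop set"
  assumes ne: "D \<noteq> {}" and bdd: "\<And>f. f \<in> D \<Longrightarrow> 0 \<le> f \<and> f \<le> t"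
    and dir: "\<And>f g. f \<in> D \<Longrightarrow> g \<in> D \<Longrightarrow> \<exists>h\<in>D. f \<le> h \<and> g \<le> h"
  shows "(\<lambda>x. SUP f\<in>D. app f x) \<in> UOp"
    and "f \<in> D \<Longrightarrow> app f x \<le> (SUP f\<in>D. app f x)"
proof -
  have upper: "app f x \<le> (SUP f\<in>D. app f x)" if "f \<in> D" for f x
    using bdd that by (intro cSUP_upper bdd_aboveI[of _ "app t x"]) (auto simp: le_app_iff le_fun_def)
  then show "f \<in> D \<Longrightarrow> app f x \<le> (SUP f\<in>D. app f x)" .
  show "(\<lambda>x. SUP f\<in>D. app f x) \<in> UOp"
    unfolding UOp_iff
  proof (intro conjI allI impI)
    fix x y :: 'a assume xy: "vdisj x y"
    let ?p = "\<lambda>x. SUP f\<in>D. app f x"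
    show "?p (x + y) = ?p x + ?p y"
    proof (rule antisym)
      show "?p (x + y) \<le> ?p x + ?p y"
        using ne upper by (intro cSUP_least) (simp_all add: UOp_add[OF app_UOp xy] add_mono)
      have le: "app f x + app g y \<le> ?p (x + y)" if fg: "f \<in> D" "g \<in> D" for f g
      proof -
        obtain h where h: "h \<in> D" "f \<le> h" "g \<le> h" using dir[OF fg] by blast
        then have "app f x + app g y \<le> app h x + app h y"
          by (intro add_mono) (simp_all add: le_app_iff le_fun_def)
        also have "\<dots> = app h (x + y)" by (simp add: UOp_add[OF app_UOp xy])
        also have "\<dots> \<le> ?p (x + y)" by (rule upper[OF h(1)])
        finally show ?thesis .
      qed
      have "?p y \<le> ?p (x + y) - app f x" if "f \<in> D" for f
        using ne le[OF that] by (intro cSUP_least) (simp_all add: algebra_simps)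
      then have "?p x \<le> ?p (x + y) - ?p y"
        using ne by (intro cSUP_least) (simp_all add: algebra_simps)
      then show "?p x + ?p y \<le> ?p (x + y)" by (simp add: le_diff_eq)
    qed
  next
    fix a b :: 'a
    obtain d where d: "\<And>x. a \<le> x \<Longrightarrow> x \<le> b \<Longrightarrow> app t x \<le> d" using UOp_bounded[OF app_UOp] by metis
    have "(SUP f\<in>D. app f x) \<le> app t x" for x
      using ne bdd by (intro cSUP_least) (auto simp: le_app_iff le_fun_def)
    moreover have "0 \<le> (SUP f\<in>D. app f x)" for x
    proof -
      obtain f where "f \<in> D" using ne by blast
      with bdd[OF this] upper[OF this, of x] show ?thesis
        by (metis le_app_iff le_fun_def order_trans zero_uop.rep_eq)
    qed
    ultimately show "\<exists>c d. \<forall>x. a \<le> x \<and> x \<le> b \<longrightarrow> c \<le> (SUP f\<in>D. app f x) \<and> (SUP f\<in>D. app f x) \<le> d"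
      using d by (meson order_trans)
  qed
qed

text \<open>The pointwise supremum of the truncations \<open>inf t (of_nat n *\<^sub>R s)\<close> is
  an operator, hence also their supremum in the lattice of operators. The last conclusion retains
  the pointwise form, which evaluation at a single \<open>x\<close> requires.\<close>

lemma U_bandproj_directed:
  fixes B :: "('a::{ordered_real_vector,lattice}, 'b::{ordered_real_vector,conditionally_complete_lattice}) uop set"
  assumes nonneg: "\<And>s. s \<in> B \<Longrightarrow> 0 \<le> s" and ne: "B \<noteq> {}"
    and dir: "\<And>s s'. s \<in> B \<Longrightarrow> s' \<in> B \<Longrightarrow> \<exists>v\<in>B. s \<le> v \<and> s' \<le> v"
    and t: "0 \<le> t"
  obtains p where "U_bandproj (app ` B) (app t) = app p" "0 \<le> p" "p \<le> t"
    and "\<And>s. s \<in> B \<Longrightarrow> inf (t - p) s = 0"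
    and "\<And>x d. (\<And>n s. s \<in> B \<Longrightarrow> app (inf t (of_nat n *\<^sub>R s)) x \<le> d) \<Longrightarrow> app p x \<le> d"
proof -
  define D where "D = {inf t (of_nat n *\<^sub>R s) |n s. s \<in> B}"
  have D_ne: "D \<noteq> {}" using ne by (auto simp: D_def)
  have D_bdd: "0 \<le> f \<and> f \<le> t" if "f \<in> D" for f
    using that nonneg t by (auto simp: D_def scaleR_nonneg_nonneg)
  have D_dir: "\<exists>h\<in>D. f \<le> h \<and> g \<le> h" if "f \<in> D" "g \<in> D" for f g
  proof -
    from that obtain n s m s' where fg: "f = inf t (of_nat n *\<^sub>R s)" "s \<in> B"
      "g = inf t (of_nat m *\<^sub>R s')" "s' \<in> B" by (auto simp: D_def)
    obtain v where v: "v \<in> B" "s \<le> v" "s' \<le> v" using dir fg by blast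
    have "of_nat n *\<^sub>R s \<le> of_nat (max n m) *\<^sub>R v" "of_nat m *\<^sub>R s' \<le> of_nat (max n m) *\<^sub>R v"
      using v nonneg fg by (auto intro!: scaleR_mono)
    then have "f \<le> inf t (of_nat (max n m) *\<^sub>R v)" "g \<le> inf t (of_nat (max n m) *\<^sub>R v)"
      unfolding fg by (auto intro: le_infI2)
    moreover have "inf t (of_nat (max n m) *\<^sub>R v) \<in> D" using v(1) by (auto simp: D_def)
    ultimately show ?thesis by blast
  qed
  have Sup_UOp: "(\<lambda>x. SUP f\<in>D. app f x) \<in> UOp"
    by (rule directed_Sup_UOp(1)[OF D_ne D_bdd D_dir]; assumption)
  define p where "p = Uop (\<lambda>x. SUP f\<in>D. app f x)"
  have p: "app p = (\<lambda>x. SUP f\<in>D. app f x)" unfolding p_def by (rule Uop_inverse[OF Sup_UOp])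
  have upper: "f \<le> p" if "f \<in> D" for f
  proof -
    have "app f x \<le> (SUP f\<in>D. app f x)" for x
      by (rule directed_Sup_UOp(2)[OF D_ne D_bdd D_dir that]; assumption)
    then show ?thesis by (simp add: le_app_iff p le_fun_def)
  qed
  have pointwise: "app p x \<le> d" if "\<And>f. f \<in> D \<Longrightarrow> app f x \<le> d" for x d
    unfolding p using D_ne that by (intro cSUP_least)
  have least: "p \<le> q" if "\<And>f. f \<in> D \<Longrightarrow> f \<le> q" for q
    using that pointwise by (simp add: le_app_iff le_fun_def)
  have inD: "inf t (of_nat n *\<^sub>R s) \<in> D" if "s \<in> B" for n s using that by (auto simp: D_def)
  have lub: "inf t (of_nat n *\<^sub>R s) \<le> p" if "s \<in> B" for n s using upper inD[OF that] .
  have lub': "p \<le> q" if "\<And>n s. s \<in> B \<Longrightarrow> inf t (of_nat n *\<^sub>R s) \<le> q" for q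
    using that by (intro least) (auto simp: D_def)
  have decomp: "0 \<le> p" "p \<le> t" "t - p \<in> disj_compl B" "p \<in> disj_compl (disj_compl B)"
    by (rule directed_band_decomp[OF nonneg ne dir t lub lub']; assumption)+
  show ?thesis
  proof (rule that)
    show "U_bandproj (app ` B) (app t) = app p" by (rule U_bandproj_app[OF decomp(4,3)])
    show "0 \<le> p" "p \<le> t" by (rule decomp(1,2))+
    show "inf (t - p) s = 0" if "s \<in> B" for s
      using decomp(2,3) that nonneg[OF that] by (auto simp: disj_compl_iff vdisj_nonneg_iff)
    show "app p x \<le> d" if "\<And>n s. s \<in> B \<Longrightarrow> app (inf t (of_nat n *\<^sub>R s)) x \<le> d" for x d
      using that by (intro pointwise) (auto simp: D_def)
  qed
qed

text \<open>By the Riesz-Kantorovich formula, \<open>inf f g\<close> at \<open>x\<close> is the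
  infimum of \<open>app f (x - y) + app g y\<close> over the fragments \<open>y\<close>.\<close>

lemma inf_eq_trivial_fragmentssD:
  assumes "inf f g = 0" "\<And>y. y \<in> fragments x \<Longrightarrow> d \<le> app f (x - y) + app g y"
  shows "d \<le> 0"
proof -
  have "app f y - app g y \<le> app f x - d" if "y \<in> fragments x" for y
    using assms(2)[OF that] UOp_fragment[OF app_UOp that, of f] by (simp add: algebra_simps)
  then have "op_pos_part (\<lambda>y. app f y - app g y) x \<le> app f x - d" by (rule op_pos_part_least)
  moreover have "app f x - op_pos_part (\<lambda>y. app f y - app g y) x = 0"
    using assms(1) by (metis inf_uop.rep_eq zero_uop.rep_eq)
  ultimately show ?thesis by simp
qed

section \<open>The projection formulas\<close>

lemma nonneg_apply:
  fixes T :: "'a \<Rightarrow> 'b::ordered_real_vector"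
  shows "(\<lambda>_. 0) \<le> T \<Longrightarrow> 0 \<le> T y"
  by (simp add: le_fun_def)

lemma UOp_projection_fragment_le:
  assumes T: "T \<in> UOp" "(\<lambda>_. 0) \<le> T" and y: "y \<in> fragments x" and \<rho>: "\<rho> \<in> band_projections"
  shows "\<rho> (T y) \<le> T x"
  using band_projection_nonneg(2)[OF \<rho> nonneg_apply[OF T(2)]] UOp_fragment_mono[OF T y]
  by (rule order_trans)

text \<open>This is the quantity \<open>G(\<epsilon>, S)\<close>, taken at the point
  \<open>x\<close>.\<close>

definition small_part_sup ::
  "('a::{ordered_real_vector,lattice} \<Rightarrow> 'b::{ordered_real_vector,conditionally_complete_lattice})
    \<Rightarrow> ('a \<Rightarrow> 'b) \<Rightarrow> 'a \<Rightarrow> real \<Rightarrow> 'b" where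
  "small_part_sup T S x \<epsilon> = Sup {\<rho> (T y) | y \<rho>.
     y \<in> fragments x \<and> \<rho> \<in> band_projections \<and> \<rho> (S y) \<le> \<epsilon> *\<^sub>R S x}"

context
  fixes S T :: "'a::{ordered_real_vector,lattice} \<Rightarrow> 'b::{ordered_real_vector,conditionally_complete_lattice}"
    and \<epsilon> :: real and x :: 'a
  assumes S: "S \<in> UOp" "(\<lambda>_. 0) \<le> S" and T: "T \<in> UOp" "(\<lambda>_. 0) \<le> T" and \<epsilon>: "0 < \<epsilon>"
begin

lemma small_part_sup_ne:
  "{\<rho> (T y) | y \<rho>. y \<in> fragments x \<and> \<rho> \<in> band_projections \<and> \<rho> (S y) \<le> \<epsilon> *\<^sub>R S x} \<noteq> {}"
proof -
  obtain \<rho> :: "'b \<Rightarrow> 'b" where \<rho>: "\<rho> \<in> band_projections"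
    using ex_projection_disj_compl[of 0] by blast
  then have "\<rho> (S 0) \<le> \<epsilon> *\<^sub>R S x"
    using \<epsilon> nonneg_apply[OF S(2), of x] by (simp add: UOp_zero[OF S(1)] band_projection_zero scaleR_nonneg_nonneg)
  with \<rho> trivial_fragments(1)[of x] show ?thesis by blast
qed

lemma small_part_sup_upper:
  assumes "y \<in> fragments x" "\<rho> \<in> band_projections" "\<rho> (S y) \<le> \<epsilon> *\<^sub>R S x"
  shows "\<rho> (T y) \<le> small_part_sup T S x \<epsilon>"
  unfolding small_part_sup_def
  by (rule cSup_upper) (use assms UOp_projection_fragment_le[OF T] in \<open>auto simp: bdd_above_def\<close>)

lemma small_part_sup_least:
  assumes "\<And>y \<rho>. y \<in> fragments x \<Longrightarrow> \<rho> \<in> band_projections \<Longrightarrow> \<rho> (S y) \<le> \<epsilon> *\<^sub>R S x \<Longrightarrow> \<rho> (T y) \<le> d"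
  shows "small_part_sup T S x \<epsilon> \<le> d"
  unfolding small_part_sup_def by (rule cSup_least[OF small_part_sup_ne]) (use assms in blast)

lemma small_part_sup_nonneg: "0 \<le> small_part_sup T S x \<epsilon>"
proof -
  obtain y \<rho> where y: "y \<in> fragments x" and \<rho>: "\<rho> \<in> band_projections" "\<rho> (S y) \<le> \<epsilon> *\<^sub>R S x"
    using small_part_sup_ne by blast
  from small_part_sup_upper[OF y \<rho>] band_projection_nonneg(1)[OF \<rho>(1) nonneg_apply[OF T(2)]] show ?thesis
    by (rule order_trans[rotated])
qed

text \<open>The first term is the value of the positive part of \<open>T - nS\<close>; the second is
  small when \<epsilon> is small for fixed \<open>n\<close>.\<close>

lemma small_part_sup_le_pos_part:
  "small_part_sup T S x \<epsilon> \<le> op_pos_part (\<lambda>y. T y - of_nat n *\<^sub>R S y) x + (of_nat n * \<epsilon>) *\<^sub>R S x"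
proof (rule small_part_sup_least)
  let ?q = "op_pos_part (\<lambda>y. T y - of_nat n *\<^sub>R S y) x"
  fix y \<rho> assume y: "y \<in> fragments x" and \<rho>: "\<rho> \<in> band_projections" and le: "\<rho> (S y) \<le> \<epsilon> *\<^sub>R S x"
  have U: "(\<lambda>y. T y - of_nat n *\<^sub>R S y) \<in> UOp" by (intro UOp_minus UOp_scaleR S T)
  have q0: "0 \<le> ?q" using op_pos_part_upper[OF U trivial_fragments(1)[of x]] by (simp add: UOp_zero S T)
  have "\<rho> (T y) = \<rho> (T y - of_nat n *\<^sub>R S y) + of_nat n *\<^sub>R \<rho> (S y)"
    by (simp add: band_projection_diff[OF \<rho>] band_projection_scaleR[OF \<rho>])
  also have "\<dots> \<le> \<rho> ?q + of_nat n *\<^sub>R (\<epsilon> *\<^sub>R S x)"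
    by (intro add_mono band_projection_mono[OF \<rho>] op_pos_part_upper[OF U y] scaleR_left_mono le) simp
  also have "\<dots> \<le> ?q + (of_nat n * \<epsilon>) *\<^sub>R S x"
    using band_projection_nonneg(2)[OF \<rho> q0] by simp
  finally show "\<rho> (T y) \<le> ?q + (of_nat n * \<epsilon>) *\<^sub>R S x" .
qed

text \<open>\<open>RS\<close> expresses at the point \<open>x\<close> that \<open>R\<close> and
  \<open>S\<close> have infimum 0. The vector \<open>p\<close> is the projection of
  \<open>R x\<close> onto the band of \<open>S x\<close>.\<close>

lemma disjoint_le_small_part_sup:
  assumes R: "R \<in> UOp" "(\<lambda>_. 0) \<le> R" "R \<le> T"
    and RS: "\<And>d. (\<And>y. y \<in> fragments x \<Longrightarrow> d \<le> R (x - y) + S y) \<Longrightarrow> d \<le> 0"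
  shows "R x \<le> small_part_sup T S x \<epsilon>"
proof -
  let ?G = "small_part_sup T S x \<epsilon>"
  have R0: "0 \<le> R y" for y using R(2) by (simp add: le_fun_def)
  define p where "p = Sup (range (\<lambda>n. inf (R x) (of_nat n *\<^sub>R S x)))"
  note p = principal_band_decomp[OF R0[of x] nonneg_apply[OF S(2), of x], folded p_def]
  \<comment> \<open>\<open>R x\<close> is cut into \<open>\<rho> (R y)\<close>, bounded by
    \<open>?G\<close>, then \<open>\<rho> (R (x - y))\<close>, and the part outside \<rho>, bounded
    by the bracket.\<close>
  have split: "R x \<le> ?G + R (x - y) + ((of_nat m / \<epsilon>) *\<^sub>R S y + (p - inf (R x) (of_nat m *\<^sub>R S x)))"
    if y: "y \<in> fragments x" for y m
  proof -
    define w where "w = sup (S y - \<epsilon> *\<^sub>R S x) 0"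
    define w' where "w' = sup (- (S y - \<epsilon> *\<^sub>R S x)) 0"
    have w0: "0 \<le> w" by (simp add: w_def)
    have w: "S y - \<epsilon> *\<^sub>R S x = w - w'" "vdisj w' w"
      using pos_neg_part[of "S y - \<epsilon> *\<^sub>R S x"] vdisj_pos_neg_part[of "S y - \<epsilon> *\<^sub>R S x"]
      by (simp_all add: w_def w'_def vdisj_sym)
    obtain \<rho> where \<rho>: "\<rho> \<in> band_projections" "\<rho> w = 0" "\<And>v. vdisj v w \<Longrightarrow> \<rho> v = v"
      using ex_projection_disj_compl[OF w0] by blast
    have compl_mono: "u - \<rho> u \<le> v - \<rho> v" if "u \<le> v" for u v
      using band_projection_nonneg(2)[OF \<rho>(1), of "v - u"] that
      by (simp add: band_projection_diff[OF \<rho>(1)] algebra_simps)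
    \<comment> \<open>\<rho> kills the positive part \<open>w\<close> and fixes the negative part
      \<open>w'\<close>.\<close>
    have eq: "\<rho> (S y) - \<epsilon> *\<^sub>R \<rho> (S x) = - w'"
      using arg_cong[OF w(1), of \<rho>] \<rho>(2) \<rho>(3)[OF w(2)]
      by (simp add: band_projection_diff[OF \<rho>(1)] band_projection_scaleR[OF \<rho>(1)])
    have "\<rho> (S y) \<le> \<epsilon> *\<^sub>R \<rho> (S x)"
    proof -
      have "- w' \<le> 0" by (simp add: w'_def)
      then show ?thesis unfolding eq[symmetric] by simp
    qed
    also have "\<dots> \<le> \<epsilon> *\<^sub>R S x"
      using \<epsilon> by (intro scaleR_left_mono band_projection_nonneg[OF \<rho>(1)] nonneg_apply[OF S(2)]) simp
    finally have "\<rho> (T y) \<le> ?G" by (rule small_part_sup_upper[OF y \<rho>(1)])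
    moreover have "\<rho> (R y) \<le> \<rho> (T y)"
      using R(3) by (intro band_projection_mono[OF \<rho>(1)]) (simp add: le_fun_def)
    ultimately have Ry: "\<rho> (R y) \<le> ?G" by order
    have Rxy: "\<rho> (R (x - y)) \<le> R (x - y)" by (intro band_projection_nonneg[OF \<rho>(1)] R0)
    \<comment> \<open>Outside \<rho> the component of \<open>S y - \<epsilon> *\<^sub>R S x\<close>
      is exactly \<open>w\<close>, which is nonnegative.\<close>
    have Sx: "S x - \<rho> (S x) \<le> (1 / \<epsilon>) *\<^sub>R S y"
    proof -
      have "\<epsilon> *\<^sub>R (S x - \<rho> (S x))
          = (S y - \<rho> (S y)) - ((S y - \<epsilon> *\<^sub>R S x) - (\<rho> (S y) - \<epsilon> *\<^sub>R \<rho> (S x)))"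
        by (simp add: algebra_simps)
      also have "\<dots> = (S y - \<rho> (S y)) - w" unfolding w(1) eq by simp
      also have "\<dots> \<le> S y"
        using w0 band_projection_nonneg(1)[OF \<rho>(1) nonneg_apply[OF S(2), of y]]
        by (simp add: algebra_simps add_nonneg_nonneg)
      finally have "(1 / \<epsilon>) *\<^sub>R (\<epsilon> *\<^sub>R (S x - \<rho> (S x))) \<le> (1 / \<epsilon>) *\<^sub>R S y"
        using \<epsilon> by (intro scaleR_left_mono) simp_all
      then show ?thesis using \<epsilon> by simp
    qed
    define i where "i = inf (R x) (of_nat m *\<^sub>R S x)"
    have i: "i \<le> of_nat m *\<^sub>R S x" "i \<le> p" using p(1)[of m] by (simp_all add: i_def)
    \<comment> \<open>\<open>R x - p\<close> is disjoint from \<open>S x\<close>, hence from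
      \<open>w\<close>, which lies below \<open>S x\<close>; so \<rho> fixes it and only
      \<open>p\<close> has a part outside \<rho>.\<close>
    have "R x - \<rho> (R x) = p - \<rho> p"
    proof -
      have "w \<le> S x"
      proof -
        have "S y - \<epsilon> *\<^sub>R S x \<le> S x"
          using UOp_fragment_mono[OF S y] \<epsilon> nonneg_apply[OF S(2), of x]
          by (simp add: algebra_simps add_increasing2 scaleR_nonneg_nonneg)
        then show ?thesis by (simp add: w_def nonneg_apply[OF S(2)])
      qed
      moreover have "vdisj (R x - p) (S x)" using p(5) by (simp add: disj_compl_iff)
      ultimately have "vdisj (R x - p) w" using w0 vdisj_nonneg_mono by blast
      from \<rho>(3)[OF this] show ?thesis by (simp add: band_projection_diff[OF \<rho>(1)] algebra_simps)
    qed
    also have "\<dots> = (i - \<rho> i) + ((p - i) - \<rho> (p - i))"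
      by (simp add: band_projection_diff[OF \<rho>(1)])
    also have "\<dots> \<le> (of_nat m *\<^sub>R S x - \<rho> (of_nat m *\<^sub>R S x)) + (p - i)"
    proof (rule add_mono)
      show "i - \<rho> i \<le> of_nat m *\<^sub>R S x - \<rho> (of_nat m *\<^sub>R S x)" by (rule compl_mono[OF i(1)])
      have "0 \<le> \<rho> (p - i)" using i(2) by (intro band_projection_nonneg[OF \<rho>(1)]) simp
      then show "p - i - \<rho> (p - i) \<le> p - i" by simp
    qed
    also have "of_nat m *\<^sub>R S x - \<rho> (of_nat m *\<^sub>R S x) = of_nat m *\<^sub>R (S x - \<rho> (S x))"
      by (simp add: band_projection_scaleR[OF \<rho>(1)] algebra_simps)
    also have "\<dots> \<le> of_nat m *\<^sub>R ((1 / \<epsilon>) *\<^sub>R S y)" by (intro scaleR_left_mono Sx) simp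
    finally have perp: "R x - \<rho> (R x) \<le> (of_nat m / \<epsilon>) *\<^sub>R S y + (p - i)" by simp
    have "R x = \<rho> (R y) + \<rho> (R (x - y)) + (R x - \<rho> (R x))"
      using UOp_fragment[OF R(1) y] by (simp add: band_projection_add[OF \<rho>(1), symmetric])
    also have "\<dots> \<le> ?G + R (x - y) + ((of_nat m / \<epsilon>) *\<^sub>R S y + (p - i))"
      by (intro add_mono Ry Rxy perp)
    finally show ?thesis unfolding i_def .
  qed
  have "inf (R x) (of_nat m *\<^sub>R S x) \<le> p - (R x - ?G)" for m
  proof -
    \<comment> \<open>\<open>K\<close> dominates both coefficients, 1 of \<open>R (x - y)\<close>
      and \<open>m / \<epsilon>\<close> of \<open>S y\<close>; dividing by it leaves the sum to
      which \<open>RS\<close> applies.\<close>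
    define K where "K = max 1 (of_nat m / \<epsilon>)"
    define i where "i = inf (R x) (of_nat m *\<^sub>R S x)"
    have K: "1 \<le> K" "of_nat m / \<epsilon> \<le> K" by (simp_all add: K_def)
    have "(1 / K) *\<^sub>R (R x - ?G - (p - i)) \<le> R (x - y) + S y" if y: "y \<in> fragments x" for y
    proof -
      have "R x - ?G - (p - i) \<le> R (x - y) + (of_nat m / \<epsilon>) *\<^sub>R S y"
        using split[OF y, of m] unfolding i_def[symmetric] by (simp add: algebra_simps)
      also have "\<dots> \<le> K *\<^sub>R R (x - y) + K *\<^sub>R S y"
        using scaleR_right_mono[OF K(1) R0[of "x - y"]] scaleR_right_mono[OF K(2) nonneg_apply[OF S(2), of y]]
        by (simp add: add_mono)
      finally have "(1 / K) *\<^sub>R (R x - ?G - (p - i)) \<le> (1 / K) *\<^sub>R (K *\<^sub>R (R (x - y) + S y))"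
        using K(1) by (intro scaleR_left_mono) (simp_all add: scaleR_add_right)
      then show ?thesis using K(1) by simp
    qed
    from RS[OF this] have "K *\<^sub>R ((1 / K) *\<^sub>R (R x - ?G - (p - i))) \<le> K *\<^sub>R 0"
      using K(1) by (intro scaleR_left_mono) simp_all
    then have "R x - ?G - (p - i) \<le> 0" using K(1) by simp
    then show ?thesis unfolding i_def[symmetric] by (simp add: algebra_simps)
  qed
  \<comment> \<open>The bound holds for every \<open>m\<close>, and \<open>p\<close> is the least
    upper bound of the left-hand sides.\<close>
  then have "p \<le> p - (R x - ?G)" by (rule p(2))
  then show ?thesis by simp
qed

end

section \<open>Exchange of suprema and infima under reflection\<close>

lemma Sup_diff_left:
  fixes c :: "'b::{ordered_real_vector,conditionally_complete_lattice}"
  assumes "X \<noteq> {}" "bdd_below X"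
  shows "Sup ((\<lambda>v. c - v) ` X) = c - Inf X"
proof (rule antisym)
  show "Sup ((\<lambda>v. c - v) ` X) \<le> c - Inf X"
    using assms by (intro cSup_least) (auto intro!: cInf_lower)
  obtain m where "\<And>v. v \<in> X \<Longrightarrow> m \<le> v" using assms(2) by (auto simp: bdd_below_def)
  then have bdd: "bdd_above ((\<lambda>v. c - v) ` X)" by (intro bdd_aboveI2[where M = "c - m"]) simp
  have "c - Sup ((\<lambda>v. c - v) ` X) \<le> Inf X"
  proof (rule cInf_greatest[OF assms(1)])
    fix v assume "v \<in> X"
    then have "c - v \<le> Sup ((\<lambda>v. c - v) ` X)" using bdd by (intro cSup_upper) auto
    then show "c - Sup ((\<lambda>v. c - v) ` X) \<le> v" by (simp add: algebra_simps)
  qed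
  then show "c - Inf X \<le> Sup ((\<lambda>v. c - v) ` X)" by (simp add: algebra_simps)
qed

lemma Inf_diff_left:
  fixes c :: "'b::{ordered_real_vector,conditionally_complete_lattice}"
  assumes "X \<noteq> {}" "bdd_above X"
  shows "Inf ((\<lambda>v. c - v) ` X) = c - Sup X"
proof -
  obtain m where "\<And>v. v \<in> X \<Longrightarrow> v \<le> m" using assms(2) by (auto simp: bdd_above_def)
  then have "bdd_below ((\<lambda>v. c - v) ` X)" by (intro bdd_belowI2[where m = "c - m"]) simp
  then show ?thesis
    using Sup_diff_left[of "(\<lambda>v. c - v) ` X" c] assms(1) by (simp add: image_image)
qed

text \<open>Each member of the set is \<open>T x - \<rho> (T (x - y))\<close>, and
  \<open>y \<mapsto> x - y\<close> is an involution of the fragments of \<open>x\<close>.\<close>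

lemma Inf_complementary_parts:
  fixes S T :: "'a::{ordered_real_vector,lattice} \<Rightarrow> 'b::{ordered_real_vector,conditionally_complete_lattice}"
  assumes S: "S \<in> UOp" "(\<lambda>_. 0) \<le> S" and T: "T \<in> UOp" "(\<lambda>_. 0) \<le> T" and \<epsilon>: "0 < \<epsilon>"
  shows "Inf {\<rho> (T y) + proj_compl \<rho> (T x) | y \<rho>.
      y \<in> fragments x \<and> \<rho> \<in> band_projections \<and> \<rho> (S (x - y)) \<le> \<epsilon> *\<^sub>R S x}
    = T x - small_part_sup T S x \<epsilon>" (is "Inf ?L = _")
proof -
  let ?X = "{\<rho> (T y) | y \<rho>. y \<in> fragments x \<and> \<rho> \<in> band_projections \<and> \<rho> (S y) \<le> \<epsilon> *\<^sub>R S x}"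
  have eq: "\<rho> (T y) + proj_compl \<rho> (T x) = T x - \<rho> (T (x - y))"
    if "y \<in> fragments x" "\<rho> \<in> band_projections" for y \<rho>
    using UOp_fragment[OF T(1) that(1)] by (simp add: proj_compl_def band_projection_add[OF that(2)])
  have "?L = (\<lambda>v. T x - v) ` ?X"
  proof (intro antisym subsetI)
    fix v assume "v \<in> ?L"
    then obtain y \<rho> where "y \<in> fragments x" "\<rho> \<in> band_projections" "\<rho> (S (x - y)) \<le> \<epsilon> *\<^sub>R S x"
      "v = T x - \<rho> (T (x - y))" using eq by blast
    then show "v \<in> (\<lambda>v. T x - v) ` ?X" using fragment_diff by blast
  next
    fix v assume "v \<in> (\<lambda>v. T x - v) ` ?X"
    then obtain y \<rho> where y: "y \<in> fragments x" "\<rho> \<in> band_projections" "\<rho> (S y) \<le> \<epsilon> *\<^sub>R S x"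
      "v = T x - \<rho> (T y)" by blast
    with eq[OF fragment_diff[OF y(1)] y(2)]
    have "v = \<rho> (T (x - y)) + proj_compl \<rho> (T x)" "\<rho> (S (x - (x - y))) \<le> \<epsilon> *\<^sub>R S x" by simp_all
    with fragment_diff[OF y(1)] y(2) show "v \<in> ?L" by blast
  qed
  moreover have "bdd_above ?X" using UOp_projection_fragment_le[OF T] by (intro bdd_aboveI[of _ "T x"]) blast
  ultimately show ?thesis
    using Inf_diff_left[OF small_part_sup_ne[OF S T \<epsilon>, of x]] by (simp add: small_part_sup_def)
qed

theorem theorem3p4:
  fixes A :: "('a::{ordered_real_vector, lattice} \<Rightarrow> 'b::{ordered_real_vector, conditionally_complete_lattice}) set"
    and T :: "'a \<Rightarrow> 'b"
    and x :: 'a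
  assumes A_pos: "A \<subseteq> {S \<in> UOp. (\<lambda>_. 0) \<le> S}"
    and A_ne: "A \<noteq> {}"
    and A_dir: "\<forall>S\<in>A. \<forall>S'\<in>A. \<exists>V\<in>A. S \<le> V \<and> S' \<le> V"
    and T_U: "T \<in> UOp" and T_pos: "(\<lambda>_. 0) \<le> T"
  shows "U_bandproj A T x =
           Sup {Inf {\<rho> (T y) + proj_compl \<rho> (T x) | y \<rho>.
                       y \<in> fragments x \<and> \<rho> \<in> band_projections \<and> \<rho> (S (x - y)) \<le> \<epsilon> *\<^sub>R S x}
                | \<epsilon> S. \<epsilon> > (0::real) \<and> S \<in> A}
         \<and> U_bandproj_perp A T x =
           Inf {Sup {\<rho> (T y) | y \<rho>.
                       y \<in> fragments x \<and> \<rho> \<in> band_projections \<and> \<rho> (S y) \<le> \<epsilon> *\<^sub>R S x}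
                | \<epsilon> S. \<epsilon> > (0::real) \<and> S \<in> A}"
proof -
  have A: "S \<in> UOp" "(\<lambda>_. 0) \<le> S" if "S \<in> A" for S using A_pos that by blast+
  define B where "B = Uop ` A"
  define t where "t = Uop T"
  have appB: "app ` B = A" using A(1) by (force simp: B_def image_image Uop_inverse)
  have appt: "app t = T" by (simp add: t_def Uop_inverse T_U)
  have B: "s \<in> B \<longleftrightarrow> app s \<in> A" for s
    using A(1) by (metis B_def appB app_inverse imageI)
  obtain p where p: "U_bandproj (app ` B) (app t) = app p" "0 \<le> p" "p \<le> t"
    and disj: "\<And>s. s \<in> B \<Longrightarrow> inf (t - p) s = 0"
    and least: "\<And>x d. (\<And>n s. s \<in> B \<Longrightarrow> app (inf t (of_nat n *\<^sub>R s)) x \<le> d) \<Longrightarrow> app p x \<le> d"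
  proof (rule U_bandproj_directed[of B t])
    show "0 \<le> s" if "s \<in> B" for s using that A by (simp add: B le_app_iff zero_uop.rep_eq)
    show "B \<noteq> {}" using A_ne by (simp add: B_def)
    show "\<exists>v\<in>B. s \<le> v \<and> s' \<le> v" if "s \<in> B" "s' \<in> B" for s s'
    proof -
      have "app s \<in> A" "app s' \<in> A" using that by (simp_all add: B)
      then obtain V where "V \<in> A" "app s \<le> V" "app s' \<le> V" using A_dir by blast
      then show ?thesis by (metis A(1) B Uop_inverse le_app_iff)
    qed
    show "0 \<le> t" by (simp add: le_app_iff zero_uop.rep_eq appt T_pos)
  qed blast
  define G where "G = {small_part_sup T S x \<epsilon> | \<epsilon> S. 0 < \<epsilon> \<and> S \<in> A}"
  obtain S0 where "S0 \<in> A" using A_ne by blast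
  then have "small_part_sup T S0 x 1 \<in> G" unfolding G_def using zero_less_one by blast
  then have G_ne: "G \<noteq> {}" by blast
  have G_bdd: "bdd_below G"
    by (rule bdd_belowI[of _ 0]) (auto simp: G_def intro: small_part_sup_nonneg[OF A T_U T_pos])
  have "Inf G \<le> T x - app p x"
  proof -
    \<comment> \<open>By the pointwise supremum formula it suffices to bound each truncation, whose
      value at \<open>x\<close> is \<open>T x - ?q\<close>.\<close>
    have "app p x \<le> T x - Inf G"
    proof (rule least)
      fix n s assume "s \<in> B"
      then have s: "app s \<in> A" by (simp add: B)
      let ?q = "op_pos_part (\<lambda>y. T y - of_nat n *\<^sub>R app s y) x"
      \<comment> \<open>Taking \<epsilon> as \<open>1 / k\<close> and multiplying by
        \<open>k\<close> makes the error independent of \<open>k\<close>, so the Archimedean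
        property replaces a limit. The case \<open>k = 0\<close>, where no such \<epsilon> exists,
        is immediate.\<close>
      have "of_nat k *\<^sub>R (Inf G - ?q) \<le> of_nat n *\<^sub>R app s x" for k
      proof (cases "k = 0")
        case True
        then show ?thesis using A(2)[OF s] by (simp add: le_fun_def scaleR_nonneg_nonneg)
      next
        case False
        then have k: "0 < 1 / real k" by simp
        have "Inf G \<le> small_part_sup T (app s) x (1 / real k)"
          using k s by (intro cInf_lower[OF _ G_bdd]) (unfold G_def, blast)
        also have "\<dots> \<le> ?q + (of_nat n * (1 / real k)) *\<^sub>R app s x"
          by (rule small_part_sup_le_pos_part[OF A[OF s] T_U T_pos k])
        finally have "of_nat k *\<^sub>R (Inf G - ?q) \<le> of_nat k *\<^sub>R ((of_nat n * (1 / real k)) *\<^sub>R app s x)"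
          by (intro scaleR_left_mono) (simp_all add: algebra_simps)
        then show ?thesis using False by simp
      qed
      then have "Inf G - ?q \<le> 0" by (rule archimedean)
      then show "app (inf t (of_nat n *\<^sub>R s)) x \<le> T x - Inf G"
        by (simp add: inf_uop.rep_eq scaleR_uop.rep_eq appt)
    qed
    then show ?thesis by (simp add: algebra_simps)
  qed
  moreover have "T x - app p x \<le> Inf G"
  proof (rule cInf_greatest[OF G_ne])
    fix g assume "g \<in> G"
    then obtain \<epsilon> S where g: "g = small_part_sup T S x \<epsilon>" "0 < \<epsilon>" and S: "S \<in> A" by (auto simp: G_def)
    have tp: "app (t - p) = (\<lambda>x. T x - app p x)" by (simp add: minus_uop.rep_eq appt)
    have "app (t - p) x \<le> small_part_sup T S x \<epsilon>"
    proof (rule disjoint_le_small_part_sup[OF A[OF S] T_U T_pos g(2)])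
      show "(\<lambda>_. 0) \<le> app (t - p)" "app (t - p) \<le> T"
        using p(2,3) by (simp_all add: le_app_iff le_fun_def tp zero_uop.rep_eq appt)
      obtain s where s: "s \<in> B" "app s = S" using S appB by blast
      show "d \<le> 0" if "\<And>y. y \<in> fragments x \<Longrightarrow> d \<le> app (t - p) (x - y) + S y" for d
        using inf_eq_trivial_fragmentssD[OF disj[OF s(1)]] that s(2) by blast
    qed simp
    then show "T x - app p x \<le> g" by (simp add: g tp)
  qed
  ultimately have eq: "T x - app p x = Inf G" by (rule antisym[rotated])
  have proj: "U_bandproj A T = app p" using p(1) by (simp add: appB appt)
  \<comment> \<open>The inner infima are the reflections \<open>T x - g\<close> of the members
    \<open>g\<close> of \<open>G\<close>, so their supremum is \<open>T x - Inf G\<close>.\<close>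
  have "{Inf {\<rho> (T y) + proj_compl \<rho> (T x) | y \<rho>.
            y \<in> fragments x \<and> \<rho> \<in> band_projections \<and> \<rho> (S (x - y)) \<le> \<epsilon> *\<^sub>R S x}
          | \<epsilon> S. \<epsilon> > (0::real) \<and> S \<in> A} = {T x - small_part_sup T S x \<epsilon> | \<epsilon> S. 0 < \<epsilon> \<and> S \<in> A}"
    by (intro Collect_cong ex_cong1 rev_conj_cong[OF refl])
      (simp add: Inf_complementary_parts[OF A T_U T_pos])
  also have "\<dots> = (\<lambda>v. T x - v) ` G" by (auto simp: G_def)
  finally have "Sup {Inf {\<rho> (T y) + proj_compl \<rho> (T x) | y \<rho>.
            y \<in> fragments x \<and> \<rho> \<in> band_projections \<and> \<rho> (S (x - y)) \<le> \<epsilon> *\<^sub>R S x}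
          | \<epsilon> S. \<epsilon> > (0::real) \<and> S \<in> A} = T x - Inf G"
    using Sup_diff_left[OF G_ne G_bdd] by simp
  then show ?thesis
    using eq unfolding proj U_bandproj_perp_def G_def small_part_sup_def by (simp add: algebra_simps)
qed

end
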